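(* Let $R$ be a crystallographic irreducible root system in the Euclidean space $(\mathfrak a,\langle\cdot,\cdot\rangle)$ with positive roots $R_+$, simple roots $\alpha_1,\dots,\alpha_n$, simple reflections $s_j=s_{\alpha_j}$, highest short root $\beta$, and a multiplicity function $k$ with $\mathrm{Re}\,k\ge0$. Put $k_j=k_{\alpha_j}+2k_{2\alpha_j}$ (with $k_{2\alpha_j}=0$ if $2\alpha_j\notin R$). The Cherednik kernel $G_k=G_k(R_+;\cdot,\cdot)$ satisfies: (i) For all $\lambda\in\mathfrak a_{\mathbb C}$ with $\langle\lambda,\beta^\vee\rangle\ne1$ (i.e. $s_0\lambda\neq\lambda$ where $s_0\lambda=\beta+s_\beta\lambda$), $$\Big(1+\frac{k_\beta}{1-\langle\lambda,\beta^\vee\rangle}\Big)G_k(\beta+s_\beta\lambda,\cdot)=\Big(e^\beta s_\beta+\frac{k_\beta}{1-\langle\lambda,\beta^\vee\rangle}\Big)G_k(\lambda,\cdot).$$ (ii) For all $j=1,\dots,n$ and $\lambda\in\mathfrak a_{\mathbb C}$ with $\langle\lambda,\alpha_j\rangle\neq0$ (i.e. $s_j\lambda\ne\lambda$), $$\Big(1+\frac{k_j}{\langle\lambda,\alpha_j^\vee\rangle}\Big)G_k(s_j\lambda,\cdot)=\Big(s_j+\frac{k_j}{\langle\lambda,\alpha_j^\vee\rangle}\Big)G_k(\lambda,\cdot).$$ Moreover, part (ii) also holds if $R$ is only an integral root system (not necessarily crystallographic and irreducible), and part (i) remains true, for an integral root system $R$, for every $\beta$ that is the highest short root of an irreducible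 component of $R$.
   Context: An integral root system in a Euclidean space $(\mathfrak a,\langle\cdot,\cdot\rangle)$ is a finite set $R\subset\mathfrak a\setminus\{0\}$ (not necessarily spanning, not necessarily reduced) with $\langle\alpha^\vee,\beta\rangle\in\mathbb Z$ and $s_\alpha R=R$ for all $\alpha,\beta\in R$, where $\alpha^\vee=2\alpha/\langle\alpha,\alpha\rangle$ and $s_\alpha$ is the orthogonal reflection in $\alpha^\perp$. It is crystallographic if it spans $\mathfrak a$. $W$ is the group generated by the $s_\alpha$; a multiplicity function is a $W$-invariant function $k:R\to\mathbb C$; $\mathrm{Re}\,k\ge0$ means $\mathrm{Re}\,k_\alpha\ge0$ for all $\alpha\in R$. The highest short root of an irreducible root system (relative to $R_+$) is the unique root of minimal length lying in the closure of the positive Weyl chamber. The inner product and the reflections are extended $\mathbb C$-linearly (bilinearly) to $\mathfrak a_{\mathbb C}$. With $\rho(k)=\frac12\sum_{\alpha\in R_+}k_\alpha\alpha$, the Cherednik operators are $$D_\xi(R_+,k)=\partial_\xi-\langle\rho(k),\xi\rangle+\sum_{\alpha\in R_+}k_\alpha\langle\alpha,\xi\rangle\frac{1-s_\alpha}{1-e^{-\alpha}},\quad\xi\in\mathfrak a,$$ with $e^{-\alpha}(x)=e^{-\langle\alpha,x\rangle}$. For $\mathrm{Re}\,k\ge0$ and $\lambda\in\mathfrak a_{\mathbb C}$, the Cherednik kernel $G_k(\lambda,\cdot)=G_k(R_+;\lambda,\cdot):\mathfrak a\to\mathbb C$ is the unique analytic function $f$ with $f(0)=1$ and $D_\xi(R_+,k)f=\langle\lambda,\xi\rangle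 f$ for all $\xi\in\mathfrak a$. Action on functions $f:\mathfrak a\to\mathbb C$: $(s_jf)(x)=f(s_jx)$ and $(e^\beta s_\beta f)(x)=e^{\langle\beta,x\rangle}f(s_\beta x)$. *)

theory Defs
  imports "HOL-Analysis.Analysis"
begin

definition coroot :: "'a::euclidean_space \<Rightarrow> 'a" where
  "coroot \<alpha> = (2 / (\<alpha> \<bullet> \<alpha>)) *\<^sub>R \<alpha>"

definition reflect :: "'a::euclidean_space \<Rightarrow> 'a \<Rightarrow> 'a" where
  "reflect \<alpha> x = x - (coroot \<alpha> \<bullet> x) *\<^sub>R \<alpha>"

definition integral_root_system :: "'a::euclidean_space set \<Rightarrow> bool" where
  "integral_root_system R \<longleftrightarrow>
     finite R \<and> 0 \<notin> R \<and>
     (\<forall>\<alpha>\<in>R. \<forall>\<beta>\<in>R. coroot \<alpha> \<bullet> \<beta> \<in> \<int>) \<and>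
     (\<forall>\<alpha>\<in>R. reflect \<alpha> ` R = R)"

definition crystallographic_root_system :: "'a::euclidean_space set \<Rightarrow> bool" where
  "crystallographic_root_system R \<longleftrightarrow> integral_root_system R \<and> span R = UNIV"

definition orthogonal_sets :: "'a::euclidean_space set \<Rightarrow> 'a set \<Rightarrow> bool" where
  "orthogonal_sets A B \<longleftrightarrow> (\<forall>a\<in>A. \<forall>b\<in>B. a \<bullet> b = 0)"

definition irreducible_roots :: "'a::euclidean_space set \<Rightarrow> bool" where
  "irreducible_roots R \<longleftrightarrow>
     R \<noteq> {} \<and>
     \<not> (\<exists>A B. A \<noteq> {} \<and> B \<noteq> {} \<and> A \<union> B = R \<and> A \<inter> B = {} \<and> orthogonal_sets A B)"

definition irreducible_component :: "'a::euclidean_space set \<Rightarrow> 'a set \<Rightarrow> bool" where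
  "irreducible_component R C \<longleftrightarrow>
     C \<subseteq> R \<and> irreducible_roots C \<and> orthogonal_sets C (R - C)"

definition positive_system :: "'a::euclidean_space set \<Rightarrow> 'a set \<Rightarrow> bool" where
  "positive_system R Rp \<longleftrightarrow>
     (\<exists>v. (\<forall>\<alpha>\<in>R. v \<bullet> \<alpha> \<noteq> 0) \<and> Rp = {\<alpha>\<in>R. 0 < v \<bullet> \<alpha>})"

definition simple_roots :: "'a::euclidean_space set \<Rightarrow> 'a set" where
  "simple_roots Rp = {\<alpha>\<in>Rp. \<not> (\<exists>\<gamma>\<in>Rp. \<exists>\<delta>\<in>Rp. \<alpha> = \<gamma> + \<delta>)}"

definition closed_chamber :: "'a::euclidean_space set \<Rightarrow> 'a set" where
  "closed_chamber Rp = {x. \<forall>\<alpha>\<in>Rp. 0 \<le> \<alpha> \<bullet> x}"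

definition highest_short_root :: "'a::euclidean_space set \<Rightarrow> 'a set \<Rightarrow> 'a \<Rightarrow> bool" where
  "highest_short_root R Rp \<beta> \<longleftrightarrow>
     \<beta> \<in> R \<and> (\<forall>\<alpha>\<in>R. norm \<beta> \<le> norm \<alpha>) \<and> \<beta> \<in> closed_chamber Rp"

text \<open>The reflections are involutions, so closing the identity under left multiplication
  by them already gives the group they generate.\<close>

inductive_set weyl_group :: "'a::euclidean_space set \<Rightarrow> ('a \<Rightarrow> 'a) set"
  for R :: "'a set" where
  "id \<in> weyl_group R"
| "\<alpha> \<in> R \<Longrightarrow> w \<in> weyl_group R \<Longrightarrow> reflect \<alpha> \<circ> w \<in> weyl_group R"

text \<open>A multiplicity function is a total function here; only its values on \<^term>\<open>R\<close> matter.\<close>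

definition multiplicity_function :: "'a::euclidean_space set \<Rightarrow> ('a \<Rightarrow> complex) \<Rightarrow> bool" where
  "multiplicity_function R k \<longleftrightarrow> (\<forall>w\<in>weyl_group R. \<forall>\<alpha>\<in>R. k (w \<alpha>) = k \<alpha>)"

definition simple_multiplicity :: "'a::euclidean_space set \<Rightarrow> ('a \<Rightarrow> complex) \<Rightarrow> 'a \<Rightarrow> complex" where
  "simple_multiplicity R k \<alpha> =
     k \<alpha> + 2 * (if 2 *\<^sub>R \<alpha> \<in> R then k (2 *\<^sub>R \<alpha>) else 0)"

text \<open>The complexification of a Euclidean space: the pair \<open>(u, v)\<close> stands for \<open>u + i v\<close>.
  Addition is that of the product type; scalar multiplication by complex numbers, the embedding
  of the real space and the complex bilinear (not sesquilinear) extension of the inner product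
  are as follows.\<close>

type_synonym 'a cplx_space = "'a \<times> 'a"

definition cvec :: "'a::euclidean_space \<Rightarrow> 'a cplx_space" where
  "cvec x = (x, 0)"

definition cscale :: "complex \<Rightarrow> 'a::euclidean_space cplx_space \<Rightarrow> 'a cplx_space" where
  "cscale c z =
     (Re c *\<^sub>R fst z - Im c *\<^sub>R snd z, Re c *\<^sub>R snd z + Im c *\<^sub>R fst z)"

definition cbilin :: "'a::euclidean_space cplx_space \<Rightarrow> 'a cplx_space \<Rightarrow> complex" where
  "cbilin z w =
     Complex (fst z \<bullet> fst w - snd z \<bullet> snd w) (fst z \<bullet> snd w + snd z \<bullet> fst w)"

definition creflect :: "'a::euclidean_space \<Rightarrow> 'a cplx_space \<Rightarrow> 'a cplx_space" where
  "creflect \<alpha> = map_prod (reflect \<alpha>) (reflect \<alpha>)"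

text \<open>Real analyticity in several variables: near every point \<open>f\<close> is the sum of a power series
  in the coordinates. Multi-indices are functions on \<^term>\<open>Basis\<close>, and the sum over them is
  unconditional.\<close>

definition real_analytic :: "('a::euclidean_space \<Rightarrow> complex) \<Rightarrow> bool" where
  "real_analytic f \<longleftrightarrow>
     (\<forall>a. \<exists>r>0. \<exists>c :: ('a \<Rightarrow> nat) \<Rightarrow> complex. \<forall>x\<in>ball a r.
        ((\<lambda>m. c m * (\<Prod>b\<in>Basis. of_real ((x - a) \<bullet> b) ^ m b)) has_sum f x)
          (Basis \<rightarrow>\<^sub>E UNIV))"

definition rho :: "'a::euclidean_space set \<Rightarrow> ('a \<Rightarrow> complex) \<Rightarrow> 'a cplx_space" where
  "rho Rp k = cscale (1/2) (\<Sum>\<alpha>\<in>Rp. cscale (k \<alpha>) (cvec \<alpha>))"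

text \<open>The operator \<open>(1 - s\<^sub>\<alpha>) / (1 - e\<^sup>-\<^sup>\<alpha>)\<close>. Its singularity on the hyperplane orthogonal
  to \<open>\<alpha>\<close> is removable on continuously differentiable functions: since
  \<open>y - s\<^sub>\<alpha> y = \<langle>\<alpha>, y\<rangle> \<alpha>\<^sup>\<or>\<close>, the quotient extends continuously by the derivative in
  direction of the coroot.\<close>

definition reflection_quotient ::
    "'a::euclidean_space \<Rightarrow> ('a \<Rightarrow> complex) \<Rightarrow> 'a \<Rightarrow> complex" where
  "reflection_quotient \<alpha> f x =
     (if \<alpha> \<bullet> x = 0 then frechet_derivative f (at x) (coroot \<alpha>)
      else (f x - f (reflect \<alpha> x)) / (1 - of_real (exp (- (\<alpha> \<bullet> x)))))"

definition cherednik_operator ::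
    "'a::euclidean_space set \<Rightarrow> ('a \<Rightarrow> complex) \<Rightarrow> 'a \<Rightarrow> ('a \<Rightarrow> complex) \<Rightarrow> 'a \<Rightarrow> complex" where
  "cherednik_operator Rp k \<xi> f x =
     frechet_derivative f (at x) \<xi> - cbilin (rho Rp k) (cvec \<xi>) * f x
     + (\<Sum>\<alpha>\<in>Rp. k \<alpha> * of_real (\<alpha> \<bullet> \<xi>) * reflection_quotient \<alpha> f x)"

definition is_cherednik_kernel ::
    "'a::euclidean_space set \<Rightarrow> ('a \<Rightarrow> complex) \<Rightarrow> 'a cplx_space \<Rightarrow> ('a \<Rightarrow> complex) \<Rightarrow> bool" where
  "is_cherednik_kernel Rp k \<mu> f \<longleftrightarrow>
     real_analytic f \<and> f 0 = 1 \<and>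
     (\<forall>\<xi> x. cherednik_operator Rp k \<xi> f x = cbilin \<mu> (cvec \<xi>) * f x)"

definition reflect_act :: "'a::euclidean_space \<Rightarrow> ('a \<Rightarrow> complex) \<Rightarrow> 'a \<Rightarrow> complex" where
  "reflect_act \<alpha> f x = f (reflect \<alpha> x)"

definition exp_reflect_act :: "'a::euclidean_space \<Rightarrow> ('a \<Rightarrow> complex) \<Rightarrow> 'a \<Rightarrow> complex" where
  "exp_reflect_act \<beta> f x = of_real (exp (\<beta> \<bullet> x)) * f (reflect \<beta> x)"

end

theory Submission imports Defs begin

text \<open>
  Both identities follow one pattern. Apply the operator on the right-hand side (a reflection, or
  a reflection twisted by an exponential, plus a constant) to \<open>G \<mu>\<close>. The result
  satisfies the radial eigenvalue equation for the reflected spectral parameter, and its value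
  at the origin is the constant on the left-hand side. With \<open>Re k \<ge> 0\<close> eigenfunctions are
  determined by their value at the origin, so the result is that constant times the kernel for
  the new parameter.

  The eigenvalue equation at a point \<open>x\<close> is used only in the radial direction
  \<open>\<xi> = x\<close>. This radial equation already forces uniqueness, and in it the coefficient
  \<open>\<langle>\<alpha>, x\<rangle>\<close> cancels the pole of \<open>1 / (1 - e\<^sup>-\<^sup>\<alpha>)\<close>, so that
  no reflecting hyperplane needs special treatment: \<open>D\<^sub>x f (x)\<close> is the radial derivative of
  \<open>f\<close> plus the sum of \<open>k\<^sub>\<alpha>\<close> times \<open>cherednik_term \<alpha> f x\<close> over
  the positive roots, and these terms involve only the regular function
  \<open>z / (1 - e\<^sup>-\<^sup>z)\<close>.

  Uniqueness (\<open>radial_eigenfunction_zero\<close>) is an energy estimate. Let \<open>f\<close> satisfy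
  the radial equation with \<open>f 0 = 0\<close>, let \<open>S\<close> be a finite reflection-stable set
  of points, and let \<open>E t\<close> be the sum of \<open>|f (t y)|\<^sup>2\<close> over
  \<open>y \<in> S\<close>. The singular part of \<open>E'\<close> at \<open>t = 0\<close> is
  \<open>- 1/t\<close> times the sum of \<open>Re k\<^sub>\<alpha> |f (t y) - f (t s\<^sub>\<alpha> y)|\<^sup>2\<close>, hence
  not positive, and the rest is bounded by a multiple of \<open>E\<close>. So \<open>E' \<le> C E\<close>,
  and \<open>E 0 = 0\<close> gives \<open>E = 0\<close>.

  The commutation relations come from the summands one by one. A reflection \<open>s\<close> carries the
  summand for \<open>\<alpha>\<close> at \<open>x\<close> to the summand for \<open>s \<alpha>\<close> at
  \<open>s x\<close>. A simple reflection at \<open>\<alpha>\<^sub>j\<close> makes only \<open>\<alpha>\<^sub>j\<close> and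
  \<open>2 \<alpha>\<^sub>j\<close> negative, and these two produce the constant \<open>k\<^sub>j\<close>
  (\<open>cherednik_operator_reflect_act\<close>). For the highest short root \<open>\<beta>\<close> the
  integers \<open>\<langle>\<alpha>\<^sup>\<or>, \<beta>\<rangle>\<close> with \<open>\<alpha> \<noteq> \<beta>\<close> positive
  are \<open>0\<close> or \<open>1\<close>; where the value is \<open>1\<close>, the exponential twist exactly
  compensates the change of sign of the root \<open>s\<^sub>\<beta> \<alpha>\<close>, so that only \<open>\<beta>\<close>
  itself contributes a correction (\<open>cherednik_operator_exp_reflect_act\<close>).
\<close>

section \<open>Reflections\<close>

lemma inner_coroot: "coroot \<alpha> \<bullet> x = 2 * (\<alpha> \<bullet> x) / (\<alpha> \<bullet> \<alpha>)"
  by (simp add: coroot_def)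

lemma linear_reflect: "linear (reflect \<alpha>)"
  unfolding reflect_def
  by (intro linearI) (simp_all add: algebra_simps)

lemmas reflect_neg = linear_neg[OF linear_reflect]
lemmas reflect_scaleR = linear_cmul[OF linear_reflect]
lemmas reflect_diff = linear_diff[OF linear_reflect]

lemma bounded_linear_reflect: "bounded_linear (reflect \<alpha>)"
  using linear_reflect linear_conv_bounded_linear by blast

lemma reflect_minus_root [simp]: "reflect (- \<alpha>) = reflect \<alpha>"
  by (simp add: reflect_def coroot_def fun_eq_iff)

lemma reflect_scaled_root: "c \<noteq> 0 \<Longrightarrow> reflect (c *\<^sub>R \<alpha>) = reflect \<alpha>"
  by (simp add: reflect_def coroot_def fun_eq_iff)

lemma reflect_orthogonal: "\<alpha> \<bullet> x = 0 \<Longrightarrow> reflect \<alpha> x = x"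
  by (simp add: reflect_def inner_coroot)

lemma reflect_self: "\<alpha> \<noteq> 0 \<Longrightarrow> reflect \<alpha> \<alpha> = - \<alpha>"
  by (simp add: reflect_def inner_coroot scaleR_2)

lemma reflect_involution [simp]: "reflect \<alpha> (reflect \<alpha> x) = x"
  by (cases "\<alpha> = 0") (simp_all add: reflect_def inner_coroot inner_diff_right field_simps)

lemma inner_reflect_swap: "reflect \<alpha> x \<bullet> y = x \<bullet> reflect \<alpha> y"
  by (simp add: reflect_def inner_coroot inner_diff_left inner_diff_right inner_commute[of x \<alpha>])

lemma inner_reflect_reflect: "reflect \<alpha> x \<bullet> reflect \<alpha> y = x \<bullet> y"
  by (simp add: inner_reflect_swap)

lemma inner_reflect: "\<beta> \<bullet> reflect \<alpha> x = \<beta> \<bullet> x - (coroot \<alpha> \<bullet> \<beta>) * (\<alpha> \<bullet> x)"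
  by (simp add: reflect_def inner_coroot inner_diff_right inner_commute[of \<beta> \<alpha>])

lemma reflect_conjugate: "reflect \<gamma> (reflect \<alpha> x) = reflect (reflect \<gamma> \<alpha>) (reflect \<gamma> x)"
proof -
  have "coroot (reflect \<gamma> \<alpha>) \<bullet> reflect \<gamma> x = coroot \<alpha> \<bullet> x"
    by (simp add: inner_coroot inner_reflect_reflect)
  then show ?thesis
    by (simp add: reflect_def[of \<alpha>] reflect_def[of "reflect \<gamma> \<alpha>"] reflect_diff reflect_scaleR)
qed

section \<open>Positive and simple roots\<close>

context
  fixes R Rp :: "'a::euclidean_space set"
  assumes R: "integral_root_system R" and Rp: "positive_system R Rp"
begin

lemma finite_roots: "finite R" and zero_notin_roots: "0 \<notin> R"
  and coroot_inner_Ints: "\<alpha> \<in> R \<Longrightarrow> \<beta> \<in> R \<Longrightarrow> coroot \<alpha> \<bullet> \<beta> \<in> \<int>"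
  and reflect_in_roots: "\<alpha> \<in> R \<Longrightarrow> \<beta> \<in> R \<Longrightarrow> reflect \<alpha> \<beta> \<in> R"
  using R unfolding integral_root_system_def by blast+

lemma uminus_in_roots: "\<alpha> \<in> R \<Longrightarrow> - \<alpha> \<in> R"
  using reflect_in_roots[of \<alpha> \<alpha>] reflect_self[of \<alpha>] zero_notin_roots by metis

lemma positive_roots_subset: "Rp \<subseteq> R"
  using Rp unfolding positive_system_def by auto

lemma finite_positive_roots: "finite Rp"
  using positive_roots_subset finite_roots finite_subset by blast

lemma uminus_notin_positive: "\<alpha> \<in> Rp \<Longrightarrow> - \<alpha> \<notin> Rp"
  using Rp unfolding positive_system_def by auto

lemma uminus_in_positive: "\<alpha> \<in> R \<Longrightarrow> \<alpha> \<notin> Rp \<Longrightarrow> - \<alpha> \<in> Rp"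
  using Rp uminus_in_roots unfolding positive_system_def by fastforce

lemma positive_root_add: "\<alpha> \<in> R \<Longrightarrow> \<beta> \<in> Rp \<Longrightarrow> \<gamma> \<in> Rp \<Longrightarrow> 0 \<le> a \<Longrightarrow> \<alpha> = \<beta> + a *\<^sub>R \<gamma> \<Longrightarrow> \<alpha> \<in> Rp"
  using Rp unfolding positive_system_def by (auto simp: inner_add_right add_pos_nonneg)

text \<open>The two integers \<open>\<langle>\<alpha>\<^sup>\<or>, \<beta>\<rangle>\<close> and
  \<open>\<langle>\<beta>\<^sup>\<or>, \<alpha>\<rangle>\<close> are positive, and by the strict Cauchy-Schwarz
  inequality their product is less than \<open>4\<close>. So one of them is \<open>1\<close>, and the
  reflection belonging to it yields the difference up to sign.\<close>

lemma root_difference: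
  assumes "\<alpha> \<in> R" "\<beta> \<in> R" and pos: "0 < \<alpha> \<bullet> \<beta>" and nonprop: "\<And>c. \<beta> \<noteq> c *\<^sub>R \<alpha>"
  shows "\<beta> - \<alpha> \<in> R"
proof -
  define t where "t = (\<alpha> \<bullet> \<beta>) / (\<alpha> \<bullet> \<alpha>)"
  have a0: "0 < \<alpha> \<bullet> \<alpha>" "0 < \<beta> \<bullet> \<beta>"
    using assms zero_notin_roots by auto
  \<comment> \<open>strict Cauchy-Schwarz, via the component of \<open>\<beta>\<close> orthogonal to \<open>\<alpha>\<close>\<close>
  have "0 < (\<beta> - t *\<^sub>R \<alpha>) \<bullet> (\<beta> - t *\<^sub>R \<alpha>)"
    using nonprop[of t] by simp
  also have "\<dots> = \<beta> \<bullet> \<beta> - t * (\<alpha> \<bullet> \<beta>)"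
    using a0 by (simp add: t_def algebra_simps inner_commute power2_eq_square)
  finally have cs: "t * (\<alpha> \<bullet> \<beta>) < \<beta> \<bullet> \<beta>" by simp
  have "(coroot \<alpha> \<bullet> \<beta>) * (coroot \<beta> \<bullet> \<alpha>) = 4 * (t * (\<alpha> \<bullet> \<beta>) / (\<beta> \<bullet> \<beta>))"
    by (simp add: inner_coroot t_def inner_commute[of \<beta> \<alpha>])
  also have "\<dots> < 4" using cs a0(2) by (simp add: divide_less_eq del: inner_gt_zero_iff)
  finally have lt4: "(coroot \<alpha> \<bullet> \<beta>) * (coroot \<beta> \<bullet> \<alpha>) < 4" .
  obtain a b where ab: "coroot \<alpha> \<bullet> \<beta> = real_of_int a" "coroot \<beta> \<bullet> \<alpha> = real_of_int b"
    using coroot_inner_Ints assms by (metis Ints_cases)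
  have "0 < coroot \<alpha> \<bullet> \<beta>" "0 < coroot \<beta> \<bullet> \<alpha>"
    using pos a0 by (simp_all add: inner_coroot inner_commute[of \<beta> \<alpha>])
  then have pos': "1 \<le> a" "1 \<le> b" using ab by auto
  have "real_of_int (a * b) < 4" using lt4 ab by simp
  then have "a * b < 4" by linarith
  then have "a = 1 \<or> b = 1"
    using mult_mono[of 2 a 2 b] pos' by fastforce
  then show ?thesis
  proof
    assume "a = 1"
    then have "reflect \<alpha> \<beta> = \<beta> - \<alpha>" using ab by (simp add: reflect_def)
    then show ?thesis using reflect_in_roots assms by metis
  next
    assume "b = 1"
    then have "- reflect \<beta> \<alpha> = \<beta> - \<alpha>" using ab by (simp add: reflect_def)
    then show ?thesis using reflect_in_roots assms uminus_in_roots by metis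
  qed
qed

text \<open>Induction on \<open>n = \<langle>\<alpha>\<^sup>\<or>, \<beta>\<rangle>\<close>: for \<open>n \<le> 0\<close> the reflection adds a
  nonnegative multiple of \<open>\<alpha>\<close>; for \<open>n > 0\<close> descend the root string from \<open>\<beta>\<close> to
  \<open>\<beta> - \<alpha>\<close>, where \<open>n\<close> drops by \<open>2\<close>, and wherever two roots that
  differ by \<open>\<alpha>\<close> had different signs, \<open>\<alpha>\<close> would be a sum of two positive
  roots.\<close>

lemma simple_reflection_positive:
  assumes "\<alpha> \<in> simple_roots Rp" "\<beta> \<in> Rp" and "\<And>c. \<beta> \<noteq> c *\<^sub>R \<alpha>"
  shows "reflect \<alpha> \<beta> \<in> Rp"
  using assms(2,3)
proof (induction "nat \<lceil>coroot \<alpha> \<bullet> \<beta>\<rceil>" arbitrary: \<beta> rule: less_induct)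
  case less
  have \<alpha>: "\<alpha> \<in> Rp" "\<alpha> \<in> R" and indec: "\<And>\<gamma> \<delta>. \<gamma> \<in> Rp \<Longrightarrow> \<delta> \<in> Rp \<Longrightarrow> \<alpha> \<noteq> \<gamma> + \<delta>"
    using assms(1) positive_roots_subset unfolding simple_roots_def by auto
  have \<beta>: "\<beta> \<in> R" using less.prems positive_roots_subset by auto
  have a0: "0 < \<alpha> \<bullet> \<alpha>" using \<alpha> zero_notin_roots by auto
  have refl: "reflect \<alpha> \<beta> \<in> R" using reflect_in_roots \<alpha> \<beta> by blast
  show ?case
  proof (cases "0 < \<alpha> \<bullet> \<beta>")
    case False
    then have "0 \<le> - (coroot \<alpha> \<bullet> \<beta>)"
      using a0 by (simp add: inner_coroot divide_nonpos_pos)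
    then show ?thesis
      by (rule positive_root_add[OF refl less.prems(1) \<alpha>(1)]) (simp add: reflect_def)
  next
    case True
    then have n: "0 < coroot \<alpha> \<bullet> \<beta>" using a0 by (simp add: inner_coroot)
    have d: "\<beta> - \<alpha> \<in> R"
      using root_difference \<alpha>(2) \<beta> True less.prems(2) by blast
    have dp: "\<beta> - \<alpha> \<in> Rp"
    proof (rule ccontr)
      \<comment> \<open>otherwise \<open>\<alpha> = \<beta> + (\<alpha> - \<beta>)\<close> would be decomposable\<close>
      assume "\<beta> - \<alpha> \<notin> Rp"
      then have "\<alpha> - \<beta> \<in> Rp" using uminus_in_positive[OF d] by simp
      then show False using indec[OF less.prems(1)] by force
    qed
    have "coroot \<alpha> \<bullet> (\<beta> - \<alpha>) = coroot \<alpha> \<bullet> \<beta> - 2"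
      using a0 by (simp add: inner_diff_right inner_coroot)
    then have "nat \<lceil>coroot \<alpha> \<bullet> (\<beta> - \<alpha>)\<rceil> < nat \<lceil>coroot \<alpha> \<bullet> \<beta>\<rceil>"
      using n by linarith
    moreover have "\<beta> - \<alpha> \<noteq> c *\<^sub>R \<alpha>" for c
      using less.prems(2)[of "c + 1"] by (auto simp: algebra_simps)
    ultimately have "reflect \<alpha> (\<beta> - \<alpha>) \<in> Rp" using less.hyps dp by blast
    then have s: "reflect \<alpha> \<beta> + \<alpha> \<in> Rp"
      using reflect_self[of \<alpha>] a0 by (simp add: reflect_diff)
    show ?thesis
    proof (rule ccontr)
      \<comment> \<open>otherwise \<open>\<alpha> = (s\<^sub>\<alpha> \<beta> + \<alpha>) + (- s\<^sub>\<alpha> \<beta>)\<close> would be decomposable\<close>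
      assume "reflect \<alpha> \<beta> \<notin> Rp"
      then show False using indec[OF s] uminus_in_positive[OF refl] by force
    qed
  qed
qed

text \<open>Integrality leaves the multiples \<open>1/2\<close>, \<open>1\<close> and \<open>2\<close>; if
  \<open>\<alpha>/2\<close> were a root, \<open>\<alpha>\<close> would be twice it and so decomposable.\<close>

lemma positive_multiple_of_simple:
  assumes "\<alpha> \<in> simple_roots Rp" "c *\<^sub>R \<alpha> \<in> Rp"
  shows "c = 1 \<or> c = 2"
proof -
  have \<alpha>: "\<alpha> \<in> Rp" "\<alpha> \<in> R" and indec: "\<And>\<gamma> \<delta>. \<gamma> \<in> Rp \<Longrightarrow> \<delta> \<in> Rp \<Longrightarrow> \<alpha> \<noteq> \<gamma> + \<delta>"
    using assms(1) positive_roots_subset unfolding simple_roots_def by auto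
  have a0: "\<alpha> \<bullet> \<alpha> \<noteq> 0" using \<alpha> zero_notin_roots by auto
  have c: "0 < c" using assms(2) \<alpha>(1) Rp unfolding positive_system_def
    by (auto simp: zero_less_mult_iff)
  have "c *\<^sub>R \<alpha> \<in> R" using assms positive_roots_subset by auto
  then obtain a b where "coroot \<alpha> \<bullet> (c *\<^sub>R \<alpha>) = real_of_int a" "coroot (c *\<^sub>R \<alpha>) \<bullet> \<alpha> = real_of_int b"
    using coroot_inner_Ints \<alpha>(2) by (metis Ints_cases)
  then have ab: "2 * c = real_of_int a" "2 / c = real_of_int b"
    using a0 c by (simp_all add: inner_coroot)
  then have "real_of_int (a * b) = 4" using c by (simp flip: ab)
  then have m: "a * b = 4" by linarith
  have "0 < real_of_int a" using c by (simp flip: ab)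
  moreover have "a \<le> 4" using m by (intro zdvd_imp_le) (auto intro: dvdI[of _ _ b])
  ultimately have "a = 1 \<or> a = 2 \<or> a = 3 \<or> a = 4" by force
  then have "a = 1 \<or> a = 2 \<or> a = 4" using m by presburger
  moreover have "a \<noteq> 1"
  proof
    assume "a = 1"
    then have "c = 1/2" using ab by simp
    then have "c + c = 1" by simp
    then have "\<alpha> = (c + c) *\<^sub>R \<alpha>" by (simp only: scaleR_one)
    then have "\<alpha> = c *\<^sub>R \<alpha> + c *\<^sub>R \<alpha>" by (simp only: scaleR_left_distrib)
    then show False using indec assms(2) by blast
  qed
  ultimately show ?thesis using ab by auto
qed

lemma simple_reflection_inversions:
  assumes "\<alpha> \<in> simple_roots Rp"
  shows "{\<beta> \<in> Rp. reflect \<alpha> \<beta> \<notin> Rp} = {\<alpha>, 2 *\<^sub>R \<alpha>} \<inter> R"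
proof -
  have \<alpha>: "\<alpha> \<in> Rp" "\<alpha> \<noteq> 0"
    using assms positive_roots_subset zero_notin_roots unfolding simple_roots_def by auto
  have "2 *\<^sub>R \<alpha> \<in> Rp" if "2 *\<^sub>R \<alpha> \<in> R"
    using positive_root_add[OF that \<alpha>(1) \<alpha>(1), of 1] by (simp add: scaleR_2)
  moreover have "reflect \<alpha> (c *\<^sub>R \<alpha>) = - (c *\<^sub>R \<alpha>)" for c
    using \<alpha>(2) by (simp add: reflect_scaleR reflect_self)
  moreover have "\<beta> \<in> {\<alpha>, 2 *\<^sub>R \<alpha>}" if \<beta>: "\<beta> \<in> Rp" "reflect \<alpha> \<beta> \<notin> Rp" for \<beta>
  proof -
    obtain c where c: "\<beta> = c *\<^sub>R \<alpha>"
      using simple_reflection_positive[OF assms \<beta>(1)] \<beta>(2) by blast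
    then show ?thesis using positive_multiple_of_simple[OF assms, of c] \<beta>(1) by auto
  qed
  moreover have "reflect \<alpha> \<alpha> = - \<alpha>" using \<alpha> by (simp add: reflect_self)
  ultimately show ?thesis
    using \<alpha>(1) positive_roots_subset uminus_notin_positive by (auto 4 4)
qed

end

text \<open>The permutation of the positive roots that a reflection induces on lines through roots. The
  sums over positive roots are reindexed along it; the sign corrections are what the commutation
  relations have to account for.\<close>

definition positive_reflection :: "'a::euclidean_space set \<Rightarrow> 'a \<Rightarrow> 'a \<Rightarrow> 'a" where
  "positive_reflection Rp \<gamma> \<alpha> = (if reflect \<gamma> \<alpha> \<in> Rp then reflect \<gamma> \<alpha> else - reflect \<gamma> \<alpha>)"

lemma sum_positive_reflection:
  assumes R: "integral_root_system R" "positive_system R Rp" and "\<gamma> \<in> R"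
  shows "(\<Sum>\<alpha>\<in>Rp. F (positive_reflection Rp \<gamma> \<alpha>)) = (\<Sum>\<alpha>\<in>Rp. F \<alpha>)"
proof -
  note pos = positive_roots_subset[OF R] uminus_notin_positive[OF R]
    uminus_in_positive[OF R] reflect_in_roots[OF R]
  have "positive_reflection Rp \<gamma> \<alpha> \<in> Rp" if "\<alpha> \<in> Rp" for \<alpha>
    using that pos assms(3) by (auto simp: positive_reflection_def)
  moreover have "positive_reflection Rp \<gamma> (positive_reflection Rp \<gamma> \<alpha>) = \<alpha>" if "\<alpha> \<in> Rp" for \<alpha>
    using that pos by (auto simp: positive_reflection_def reflect_neg)
  ultimately show ?thesis
    by (intro sum.reindex_bij_witness[of Rp "positive_reflection Rp \<gamma>" "positive_reflection Rp \<gamma>"]) auto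
qed

lemma multiplicity_positive_reflection:
  assumes R: "integral_root_system R" "positive_system R Rp"
    and k: "multiplicity_function R k" and "\<gamma> \<in> R" "\<alpha> \<in> Rp"
  shows "k (positive_reflection Rp \<gamma> \<alpha>) = k \<alpha>"
proof -
  have inv: "k (reflect \<delta> \<epsilon>) = k \<epsilon>" if "\<delta> \<in> R" "\<epsilon> \<in> R" for \<delta> \<epsilon>
  proof -
    have "reflect \<delta> \<circ> id \<in> weyl_group R" using that by (intro weyl_group.intros)
    then show ?thesis using k that unfolding multiplicity_function_def by force
  qed
  have \<alpha>: "\<alpha> \<in> R" using assms positive_roots_subset[OF R] by auto
  have r: "reflect \<gamma> \<alpha> \<in> R" using reflect_in_roots[OF R] \<alpha> assms(4) by blast
  then have "reflect \<gamma> \<alpha> \<noteq> 0" using zero_notin_roots[OF R] by auto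
  then have "k (- reflect \<gamma> \<alpha>) = k (reflect \<gamma> \<alpha>)"
    using inv[OF r r] by (simp add: reflect_self)
  then show ?thesis using inv[OF assms(4) \<alpha>] by (simp add: positive_reflection_def)
qed

section \<open>The radial part of the Cherednik operators\<close>

lemma cbilin_cvec: "cbilin z (cvec x) = Complex (fst z \<bullet> x) (snd z \<bullet> x)"
  by (simp add: cbilin_def cvec_def)

lemma cbilin_cvec_cvec: "cbilin (cvec x) (cvec y) = of_real (x \<bullet> y)"
  by (simp add: cbilin_def cvec_def complex_of_real_def)

lemma cbilin_add_left: "cbilin (z + w) (cvec x) = cbilin z (cvec x) + cbilin w (cvec x)"
  by (simp add: cbilin_cvec inner_add_left complex_eq_iff)

lemma cbilin_cscale_left: "cbilin (cscale c z) (cvec x) = c * cbilin z (cvec x)"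
  by (simp add: cbilin_cvec cscale_def complex_eq_iff inner_add_left inner_diff_left)

lemma cbilin_scaleR_right: "cbilin z (cvec (r *\<^sub>R x)) = of_real r * cbilin z (cvec x)"
  by (simp add: cbilin_cvec complex_eq_iff)

lemma cbilin_sum_left: "cbilin (\<Sum>i\<in>I. z i) (cvec x) = (\<Sum>i\<in>I. cbilin (z i) (cvec x))"
  by (induction I rule: infinite_finite_induct)
    (simp_all add: cbilin_add_left, simp_all add: cbilin_cvec complex_eq_iff)

lemma cbilin_creflect: "cbilin (creflect \<alpha> \<mu>) (cvec x) = cbilin \<mu> (cvec (reflect \<alpha> x))"
  by (simp add: cbilin_cvec creflect_def inner_reflect_swap)

lemma cbilin_reflect:
  "cbilin \<mu> (cvec (reflect \<alpha> x)) = cbilin \<mu> (cvec x) - cbilin \<mu> (cvec (coroot \<alpha>)) * of_real (\<alpha> \<bullet> x)"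
  by (simp add: cbilin_cvec complex_eq_iff reflect_def coroot_def inner_diff_right)

text \<open>The generating function \<open>z / (1 - e\<^sup>-\<^sup>z)\<close> of the Todd class. The value at
  \<open>0\<close> is the limit; the estimate \<open>todd_bound\<close> near \<open>0\<close> relies on it.\<close>

definition todd :: "real \<Rightarrow> real" where
  "todd z = (if z = 0 then 1 else z / (1 - exp (- z)))"

lemma todd_mult: "todd z * (1 - exp (- z)) = z"
  by (simp add: todd_def)

lemma todd_minus: "todd (- z) = todd z - z"
proof (cases "z = 0")
  case False
  have "1 - exp (- z) \<noteq> 0" using False by simp
  moreover have "(todd (- z) - (todd z - z)) * (1 - exp (- z)) = 0"
  proof -
    have "todd (- z) * (1 - exp z) = - z" using todd_mult[of "- z"] by simp
    then have "todd (- z) * (1 - exp z) * exp (- z) = - z * exp (- z)" by simp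
    then have "todd (- z) * (1 - exp (- z)) = z * exp (- z)"
      by (simp add: algebra_simps flip: exp_add)
    then show ?thesis using todd_mult[of z] by (simp add: algebra_simps)
  qed
  ultimately show ?thesis by (metis eq_iff_diff_eq_0 mult_eq_0_iff)
qed (simp add: todd_def)

text \<open>This isolates the singular part of the radial equation along a ray: \<open>todd (t a) / t\<close>
  differs from \<open>1 / t\<close> by at most \<open>\<bar>a\<bar>\<close>, uniformly in \<open>t\<close>. For positive
  arguments it amounts to \<open>1 \<le> todd z \<le> 1 + z\<close>, and negative ones reduce to these by
  \<open>todd_minus\<close>.\<close>

lemma todd_bound: "\<bar>todd z - 1\<bar> \<le> \<bar>z\<bar>"
proof -
  have pos: "1 \<le> todd z \<and> todd z \<le> 1 + z" if "0 < z" for z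
  proof -
    have e: "0 < 1 - exp (- z)" using that by simp
    have "1 - exp (- z) \<le> z" using exp_ge_add_one_self[of "- z"] by linarith
    moreover have "z \<le> (1 + z) * (1 - exp (- z))"
    proof -
      have "(1 + z) * exp (- z) \<le> exp z * exp (- z)"
        using exp_ge_add_one_self[of z] by (intro mult_right_mono) auto
      then show ?thesis by (simp add: algebra_simps flip: exp_add)
    qed
    ultimately show ?thesis
      using that e by (simp add: todd_def divide_le_eq le_divide_eq)
  qed
  consider "z = 0" | "0 < z" | "z < 0" by linarith
  then show ?thesis
  proof cases
    case 3
    then show ?thesis using pos[of "- z"] todd_minus[of z] by simp
  qed (use pos[of z] in \<open>auto simp: todd_def\<close>)
qed

text \<open>The contribution of one positive root to the Cherednik operator at \<open>x\<close> in the
  direction \<open>\<xi> = x\<close>, including its share of \<open>\<rho>(k)\<close>. With that share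
  included, the twisted reflection at the highest short root \<open>\<beta>\<close> permutes the terms
  of the other positive roots up to the factor \<open>e\<^sup>\<beta>\<close>.\<close>

definition cherednik_term :: "'a::euclidean_space \<Rightarrow> ('a \<Rightarrow> complex) \<Rightarrow> 'a \<Rightarrow> complex" where
  "cherednik_term \<alpha> f x =
     of_real (todd (\<alpha> \<bullet> x)) * (f x - f (reflect \<alpha> x)) - of_real (\<alpha> \<bullet> x) / 2 * f x"

text \<open>On the hyperplane orthogonal to \<open>\<alpha>\<close> the derivative that replaces the difference
  quotient has coefficient \<open>\<langle>\<alpha>, x\<rangle> = 0\<close>, so the formula is uniform in
  \<open>x\<close>.\<close>

lemma radial_cherednik_operator:
  "cherednik_operator Rp k x f x =
     frechet_derivative f (at x) x + (\<Sum>\<alpha>\<in>Rp. k \<alpha> * cherednik_term \<alpha> f x)"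
proof -
  have "k \<alpha> * cherednik_term \<alpha> f x =
      k \<alpha> * of_real (\<alpha> \<bullet> x) * reflection_quotient \<alpha> f x - k \<alpha> * of_real (\<alpha> \<bullet> x) / 2 * f x" for \<alpha>
  proof (cases "\<alpha> \<bullet> x = 0")
    case True
    then show ?thesis by (simp add: cherednik_term_def reflect_orthogonal)
  next
    case False
    then have q: "reflection_quotient \<alpha> f x * of_real (\<alpha> \<bullet> x) =
        of_real (todd (\<alpha> \<bullet> x)) * (f x - f (reflect \<alpha> x))"
      by (simp add: reflection_quotient_def todd_def)
    show ?thesis
      unfolding cherednik_term_def q[symmetric] by (simp add: algebra_simps)
  qed
  moreover have "cbilin (rho Rp k) (cvec x) = (\<Sum>\<alpha>\<in>Rp. k \<alpha> * of_real (\<alpha> \<bullet> x) / 2)"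
    by (simp add: rho_def cbilin_cscale_left cbilin_sum_left cbilin_cvec_cvec sum_divide_distrib)
  ultimately show ?thesis
    by (simp add: cherednik_operator_def sum_subtractf sum_distrib_right)
qed

lemma cherednik_term_minus:
  "cherednik_term (- \<alpha>) f x = cherednik_term \<alpha> f x + of_real (\<alpha> \<bullet> x) * f (reflect \<alpha> x)"
  by (simp add: cherednik_term_def todd_minus algebra_simps)

lemma cherednik_term_reflect:
  "cherednik_term \<alpha> (reflect_act \<gamma> f) x = cherednik_term (reflect \<gamma> \<alpha>) f (reflect \<gamma> x)"
  by (simp add: cherednik_term_def reflect_act_def inner_reflect_reflect reflect_conjugate[of \<gamma> \<alpha>])

lemma cherednik_term_linear:
  "cherednik_term \<alpha> (\<lambda>y. a * f y + b * g y) x =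
    a * cherednik_term \<alpha> f x + b * cherednik_term \<alpha> g x"
  by (simp add: cherednik_term_def algebra_simps)

lemma radial_cherednik_operator_linear:
  assumes "f differentiable at x" "g differentiable at x"
  shows "cherednik_operator Rp k x (\<lambda>y. a * f y + b * g y) x =
    a * cherednik_operator Rp k x f x + b * cherednik_operator Rp k x g x"
proof -
  have "((\<lambda>y. a * f y + b * g y) has_derivative
      (\<lambda>h. a * frechet_derivative f (at x) h + b * frechet_derivative g (at x) h)) (at x)"
    using assms frechet_derivative_works by (auto intro!: derivative_intros)
  then have "frechet_derivative (\<lambda>y. a * f y + b * g y) (at x) =
      (\<lambda>h. a * frechet_derivative f (at x) h + b * frechet_derivative g (at x) h)"
    using frechet_derivative_at by metis
  then show ?thesis
    unfolding radial_cherednik_operator cherednik_term_linear distrib_left sum.distrib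
    by (simp add: sum_distrib_left mult.left_commute)
qed

section \<open>Uniqueness of the Cherednik kernel\<close>

text \<open>A finite set that contains the Weyl group orbit of \<open>x\<close>: orbit points lie in
  \<open>x + span R\<close>, and their inner products with the roots are among the finitely many values
  \<open>\<langle>x, \<beta>\<rangle>\<close>. Those inner products determine a point of \<open>x + span R\<close>,
  which gives finiteness.\<close>

lemma finite_reflection_stable_set:
  fixes R :: "'a::euclidean_space set"
  assumes R: "integral_root_system R"
  obtains S where "finite S" "x \<in> S" "\<And>\<alpha> y. \<alpha> \<in> R \<Longrightarrow> y \<in> S \<Longrightarrow> reflect \<alpha> y \<in> S"
proof -
  define S where "S = {y. y - x \<in> span R \<and> (\<forall>\<beta>\<in>R. y \<bullet> \<beta> \<in> (\<lambda>\<beta>. x \<bullet> \<beta>) ` R)}"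
  have fin: "finite R" and refl: "\<And>\<alpha> \<beta>. \<alpha> \<in> R \<Longrightarrow> \<beta> \<in> R \<Longrightarrow> reflect \<alpha> \<beta> \<in> R"
    using R unfolding integral_root_system_def by blast+
  have x: "x \<in> S" by (auto simp: S_def span_zero)
  have stable: "reflect \<alpha> y \<in> S" if "\<alpha> \<in> R" "y \<in> S" for \<alpha> y
  proof -
    have "reflect \<alpha> y - x = (y - x) - (coroot \<alpha> \<bullet> y) *\<^sub>R \<alpha>" by (simp add: reflect_def)
    also have "\<dots> \<in> span R"
      using that by (intro span_diff[OF _ span_scale[OF span_base]]) (auto simp: S_def)
    finally show ?thesis
      using that refl unfolding S_def inner_reflect_swap mem_Collect_eq by blast
  qed
  have "inj_on (\<lambda>y. restrict (\<lambda>\<beta>. y \<bullet> \<beta>) R) S"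
  proof
    fix y z assume yz: "y \<in> S" "z \<in> S" "restrict (\<lambda>\<beta>. y \<bullet> \<beta>) R = restrict (\<lambda>\<beta>. z \<bullet> \<beta>) R"
    have "(y - z) \<bullet> \<beta> = 0" if "\<beta> \<in> R" for \<beta>
      using fun_cong[OF yz(3), of \<beta>] that by (simp add: inner_diff_left)
    moreover have "y - z \<in> span R"
      using yz span_diff[of "y - x" R "z - x"] by (simp add: S_def)
    ultimately have "(y - z) \<bullet> (y - z) = 0"
      using orthogonal_to_span[of "y - z" R "y - z"] by (simp add: orthogonal_def)
    then show "y = z" by simp
  qed
  moreover have "(\<lambda>y. restrict (\<lambda>\<beta>. y \<bullet> \<beta>) R) ` S \<subseteq> R \<rightarrow>\<^sub>E (\<lambda>\<beta>. x \<bullet> \<beta>) ` R"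
    by (auto simp: S_def)
  moreover have "finite (R \<rightarrow>\<^sub>E (\<lambda>\<beta>. x \<bullet> \<beta>) ` R)"
    using fin by (intro finite_PiE) auto
  ultimately have "finite S" by (rule inj_on_finite)
  then show ?thesis using x stable by (rule that)
qed

text \<open>Summation by parts: average the sum with its image under the involution
  \<open>y \<mapsto> s\<^sub>\<alpha> y\<close> of \<open>S\<close>. This is where the singular part of the radial
  equation acquires a sign.\<close>

lemma sum_reflection_energy:
  fixes u :: "'a::euclidean_space \<Rightarrow> complex"
  assumes "\<And>y. y \<in> S \<Longrightarrow> reflect \<alpha> y \<in> S"
  shows "2 * (\<Sum>y\<in>S. cnj (u y) * (u y - u (reflect \<alpha> y))) =
    of_real (\<Sum>y\<in>S. (norm (u y - u (reflect \<alpha> y)))\<^sup>2)"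
proof -
  have "(\<Sum>y\<in>S. cnj (u y) * (u y - u (reflect \<alpha> y))) =
      (\<Sum>y\<in>S. cnj (u (reflect \<alpha> y)) * (u (reflect \<alpha> y) - u y))"
    using assms by (intro sum.reindex_bij_witness[of S "reflect \<alpha>" "reflect \<alpha>"]) auto
  then have "2 * (\<Sum>y\<in>S. cnj (u y) * (u y - u (reflect \<alpha> y))) =
      (\<Sum>y\<in>S. cnj (u y) * (u y - u (reflect \<alpha> y))
        + cnj (u (reflect \<alpha> y)) * (u (reflect \<alpha> y) - u y))"
    by (simp add: sum.distrib)
  also have "\<dots> = (\<Sum>y\<in>S. of_real ((norm (u y - u (reflect \<alpha> y)))\<^sup>2))"
    by (intro sum.cong refl) (simp only: complex_norm_square, simp add: algebra_simps)
  finally show ?thesis by simp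
qed

text \<open>The differential inequality is required only inside the interval because the radial equation is
  singular at \<open>t = 0\<close>.\<close>

lemma gronwall_zero:
  fixes E E' :: "real \<Rightarrow> real"
  assumes cont: "continuous_on {0..1} E" and "E 0 = 0"
    and deriv: "\<And>t. 0 < t \<Longrightarrow> t < 1 \<Longrightarrow> (E has_real_derivative E' t) (at t)"
    and le: "\<And>t. 0 < t \<Longrightarrow> t < 1 \<Longrightarrow> E' t \<le> C * E t"
  shows "E 1 \<le> 0"
proof -
  have "exp (- C * 1) * E 1 \<le> exp (- C * 0) * E 0"
  proof (rule DERIV_nonpos_imp_decreasing_open[where f = "\<lambda>t. exp (- C * t) * E t"])
    fix t :: real assume t: "0 < t" "t < 1"
    have "((\<lambda>t. exp (- C * t) * E t) has_real_derivative exp (- C * t) * (E' t - C * E t)) (at t)"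
      by (rule derivative_eq_intros deriv[OF t] refl)+ (simp add: algebra_simps)
    moreover have "exp (- C * t) * (E' t - C * E t) \<le> 0"
      using le[OF t] by (simp add: mult_nonneg_nonpos)
    ultimately show "\<exists>y. ((\<lambda>t. exp (- C * t) * E t) has_real_derivative y) (at t) \<and> y \<le> 0"
      by (intro exI conjI)
  qed (auto intro!: continuous_intros cont)
  then show ?thesis using assms(2) by (simp add: mult_le_0_iff)
qed

text \<open>Along the rays through the points \<open>y\<close> of a finite reflection-stable set, the functions
  \<open>u y t = f (t y)\<close> satisfy the linear system
  \<open>u'(y) = B(y) - 1/t \<Sum> k\<^sub>\<alpha> (u(y) - u(s\<^sub>\<alpha> y))\<close>, with \<open>B\<close> bounded by
  a constant times the square root of the energy \<open>E\<close>. The singular part decreases the energy since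
  \<open>Re k \<ge> 0\<close>, and Gronwall's inequality applies.\<close>

lemma radial_eigenfunction_zero:
  fixes f :: "'a::euclidean_space \<Rightarrow> complex"
  assumes R: "integral_root_system R" "Rp \<subseteq> R"
    and k: "\<And>\<alpha>. \<alpha> \<in> Rp \<Longrightarrow> 0 \<le> Re (k \<alpha>)"
    and diff: "\<And>x. f differentiable at x"
    and eigen: "\<And>x. cherednik_operator Rp k x f x = cbilin \<mu> (cvec x) * f x"
    and f0: "f 0 = 0"
  shows "f x = 0"
proof -
  obtain S where S: "finite S" "x \<in> S"
    and "\<And>\<alpha> y. \<alpha> \<in> R \<Longrightarrow> y \<in> S \<Longrightarrow> reflect \<alpha> y \<in> S"
    using finite_reflection_stable_set[OF R(1), of x] by blast
  then have stable: "\<And>\<alpha> y. \<alpha> \<in> Rp \<Longrightarrow> y \<in> S \<Longrightarrow> reflect \<alpha> y \<in> S"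
    using R(2) by blast
  define u where "u = (\<lambda>y t. f (t *\<^sub>R y))"
  define u' where "u' = (\<lambda>y t. frechet_derivative f (at (t *\<^sub>R y)) y)"
  define B where "B = (\<lambda>y t. cbilin \<mu> (cvec y) * u y t - (\<Sum>\<alpha>\<in>Rp. k \<alpha> *
      (of_real ((todd (t * (\<alpha> \<bullet> y)) - 1) / t) * (u y t - u (reflect \<alpha> y) t)
        - of_real (\<alpha> \<bullet> y) / 2 * u y t)))"
  define E where "E = (\<lambda>t. \<Sum>y\<in>S. (norm (u y t))\<^sup>2)"
  define E' where "E' = (\<lambda>t. \<Sum>y\<in>S. 2 * (u y t \<bullet> u' y t))"
  define M where "M = (\<lambda>y. norm (cbilin \<mu> (cvec y))
      + (\<Sum>\<alpha>\<in>Rp. norm (k \<alpha>) * (\<bar>\<alpha> \<bullet> y\<bar> * 2 + \<bar>\<alpha> \<bullet> y\<bar> / 2)))"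
  have f': "(f has_derivative frechet_derivative f (at z)) (at z)" for z
    using diff frechet_derivative_works by blast
  have "(u y has_vector_derivative u' y t) (at t)" for y t
  proof -
    have "((\<lambda>t. t *\<^sub>R y) has_derivative (\<lambda>h. h *\<^sub>R y)) (at t)"
      by (auto intro!: derivative_eq_intros)
    from has_derivative_compose[OF this f']
    have "((\<lambda>t. f (t *\<^sub>R y)) has_derivative (\<lambda>h. frechet_derivative f (at (t *\<^sub>R y)) (h *\<^sub>R y))) (at t)" .
    then show ?thesis
      using linear_cmul[OF has_derivative_linear[OF f']]
      by (simp add: has_vector_derivative_def u_def u'_def)
  qed
  then have E': "(E has_real_derivative E' t) (at t)" for t
    unfolding E_def E'_def power2_norm_eq_inner has_real_derivative_iff_has_vector_derivative
    by (intro has_vector_derivative_sum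
        has_vector_derivative_eq_rhs[OF bounded_bilinear.has_vector_derivative[OF bounded_bilinear_inner]])
      (auto simp: inner_commute)
  have radial: "of_real t * u' y t = of_real t * B y t
      - (\<Sum>\<alpha>\<in>Rp. k \<alpha> * (u y t - u (reflect \<alpha> y) t))" if "0 < t" for y t
  proof -
    have "of_real t * u' y t = frechet_derivative f (at (t *\<^sub>R y)) (t *\<^sub>R y)"
      using linear_cmul[OF has_derivative_linear[OF f']]
      by (simp add: u'_def scaleR_conv_of_real)
    also have "\<dots> = cbilin \<mu> (cvec (t *\<^sub>R y)) * u y t
        - (\<Sum>\<alpha>\<in>Rp. k \<alpha> * cherednik_term \<alpha> f (t *\<^sub>R y))"
      using eigen[of "t *\<^sub>R y"] unfolding radial_cherednik_operator u_def
      by (simp add: algebra_simps)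
    also have "(\<Sum>\<alpha>\<in>Rp. k \<alpha> * cherednik_term \<alpha> f (t *\<^sub>R y)) =
        (\<Sum>\<alpha>\<in>Rp. of_real t * (k \<alpha> *
          (of_real ((todd (t * (\<alpha> \<bullet> y)) - 1) / t) * (u y t - u (reflect \<alpha> y) t)
            - of_real (\<alpha> \<bullet> y) / 2 * u y t))
          + k \<alpha> * (u y t - u (reflect \<alpha> y) t))"
      using that
      by (intro sum.cong refl)
        (simp add: cherednik_term_def u_def reflect_scaleR field_simps)
    finally show ?thesis
      by (simp add: B_def cbilin_scaleR_right sum.distrib sum_distrib_left right_diff_distrib)
  qed
  have u_le: "norm (u y t) \<le> sqrt (E t)" if "y \<in> S" for y t
    unfolding E_def using that S(1)
    by (intro real_le_rsqrt member_le_sum[where f = "\<lambda>y. (norm (u y t))\<^sup>2"]) auto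
  have B_le: "norm (B y t) \<le> M y * sqrt (E t)" if "0 < t" "y \<in> S" for y t
  proof -
    have "norm (k \<alpha> * (of_real ((todd (t * (\<alpha> \<bullet> y)) - 1) / t) * (u y t - u (reflect \<alpha> y) t)
        - of_real (\<alpha> \<bullet> y) / 2 * u y t))
        \<le> norm (k \<alpha>) * (\<bar>\<alpha> \<bullet> y\<bar> * 2 + \<bar>\<alpha> \<bullet> y\<bar> / 2) * sqrt (E t)" if "\<alpha> \<in> Rp" for \<alpha>
    proof -
      have 1: "\<bar>(todd (t * (\<alpha> \<bullet> y)) - 1) / t\<bar> \<le> \<bar>\<alpha> \<bullet> y\<bar>"
        using todd_bound[of "t * (\<alpha> \<bullet> y)"] \<open>0 < t\<close>
        by (simp add: abs_divide divide_le_eq abs_mult mult.commute)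
      have 2: "norm (u y t - u (reflect \<alpha> y) t) \<le> 2 * sqrt (E t)"
        using norm_triangle_ineq4[of "u y t" "u (reflect \<alpha> y) t"] u_le[OF \<open>y \<in> S\<close>, of t]
          u_le[OF stable[OF that \<open>y \<in> S\<close>], of t] by linarith
      have "norm (of_real ((todd (t * (\<alpha> \<bullet> y)) - 1) / t) * (u y t - u (reflect \<alpha> y) t)
          - of_real (\<alpha> \<bullet> y) / 2 * u y t)
          \<le> \<bar>(todd (t * (\<alpha> \<bullet> y)) - 1) / t\<bar> * norm (u y t - u (reflect \<alpha> y) t)
            + \<bar>\<alpha> \<bullet> y\<bar> / 2 * norm (u y t)"
        by (rule norm_triangle_le_diff) (simp add: norm_mult del: of_real_diff of_real_divide)
      also have "\<dots> \<le> \<bar>\<alpha> \<bullet> y\<bar> * (2 * sqrt (E t)) + \<bar>\<alpha> \<bullet> y\<bar> / 2 * sqrt (E t)"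
        using 1 2 u_le[OF \<open>y \<in> S\<close>, of t] by (intro add_mono mult_mono) auto
      also have "\<dots> = (\<bar>\<alpha> \<bullet> y\<bar> * 2 + \<bar>\<alpha> \<bullet> y\<bar> / 2) * sqrt (E t)"
        by (simp add: algebra_simps)
      finally show ?thesis
        unfolding norm_mult[of "k \<alpha>"] mult.assoc[of "norm (k \<alpha>)"]
        by (rule mult_left_mono) simp
    qed
    then have "norm (\<Sum>\<alpha>\<in>Rp. k \<alpha> * (of_real ((todd (t * (\<alpha> \<bullet> y)) - 1) / t) * (u y t - u (reflect \<alpha> y) t)
        - of_real (\<alpha> \<bullet> y) / 2 * u y t))
        \<le> (\<Sum>\<alpha>\<in>Rp. norm (k \<alpha>) * (\<bar>\<alpha> \<bullet> y\<bar> * 2 + \<bar>\<alpha> \<bullet> y\<bar> / 2) * sqrt (E t))"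
      by (rule sum_norm_le)
    moreover have "norm (cbilin \<mu> (cvec y) * u y t) \<le> norm (cbilin \<mu> (cvec y)) * sqrt (E t)"
      using u_le[OF \<open>y \<in> S\<close>, of t] by (simp add: norm_mult mult_left_mono)
    ultimately show ?thesis
      unfolding B_def M_def distrib_right sum_distrib_right
      by (intro norm_triangle_le_diff add_mono)
  qed
  have E'_le: "E' t \<le> (2 * sum M S) * E t" if "0 < t" for t
  proof -
    have E0: "0 \<le> E t" by (auto simp: E_def intro: sum_nonneg)
    have "Re (\<Sum>y\<in>S. \<Sum>\<alpha>\<in>Rp. 2 * (k \<alpha> * (cnj (u y t) * (u y t - u (reflect \<alpha> y) t))))
        = Re (\<Sum>\<alpha>\<in>Rp. k \<alpha> * (2 * (\<Sum>y\<in>S. cnj (u y t) * (u y t - u (reflect \<alpha> y) t))))"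
      by (subst sum.swap) (simp add: sum_distrib_left algebra_simps)
    also have "\<dots> = (\<Sum>\<alpha>\<in>Rp. Re (k \<alpha>) * (\<Sum>y\<in>S. (norm (u y t - u (reflect \<alpha> y) t))\<^sup>2))"
    proof -
      have "2 * (\<Sum>y\<in>S. cnj (u y t) * (u y t - u (reflect \<alpha> y) t)) =
          of_real (\<Sum>y\<in>S. (norm (u y t - u (reflect \<alpha> y) t))\<^sup>2)" if "\<alpha> \<in> Rp" for \<alpha>
        using stable[OF that] by (rule sum_reflection_energy)
      then have "(\<Sum>\<alpha>\<in>Rp. k \<alpha> * (2 * (\<Sum>y\<in>S. cnj (u y t) * (u y t - u (reflect \<alpha> y) t)))) =
          (\<Sum>\<alpha>\<in>Rp. k \<alpha> * of_real (\<Sum>y\<in>S. (norm (u y t - u (reflect \<alpha> y) t))\<^sup>2))"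
        by (intro sum.cong) auto
      then show ?thesis by (simp del: of_real_sum)
    qed
    also have "\<dots> \<ge> 0"
      using k by (intro sum_nonneg mult_nonneg_nonneg) auto
    finally have pos: "0 \<le> Re (\<Sum>y\<in>S. \<Sum>\<alpha>\<in>Rp. 2 * (k \<alpha> * (cnj (u y t) * (u y t - u (reflect \<alpha> y) t))))" .
    have "t * E' t = Re (\<Sum>y\<in>S. 2 * cnj (u y t) * (of_real t * u' y t))"
      by (simp add: E'_def sum_distrib_left inner_complex_def algebra_simps)
    also have "\<dots> = t * (\<Sum>y\<in>S. 2 * (u y t \<bullet> B y t))
        - Re (\<Sum>y\<in>S. \<Sum>\<alpha>\<in>Rp. 2 * (k \<alpha> * (cnj (u y t) * (u y t - u (reflect \<alpha> y) t))))"
    proof -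
      have eq: "2 * cnj (u y t) * (of_real t * u' y t) = of_real t * (2 * (cnj (u y t) * B y t))
          - (\<Sum>\<alpha>\<in>Rp. 2 * (k \<alpha> * (cnj (u y t) * (u y t - u (reflect \<alpha> y) t))))" for y
        unfolding radial[OF that] right_diff_distrib sum_distrib_left
        by (simp add: algebra_simps)
      have "Re (of_real t * (2 * (cnj (u y t) * B y t))) = t * (2 * (u y t \<bullet> B y t))" for y
        by (simp add: inner_complex_def)
      then show ?thesis
        unfolding eq sum_subtractf minus_complex.sel Re_sum[of "\<lambda>y. of_real t * _ y"] sum_distrib_left
        by (simp only:)
    qed
    also have "\<dots> \<le> t * (\<Sum>y\<in>S. 2 * (u y t \<bullet> B y t))"
      using pos by simp
    finally have "E' t \<le> (\<Sum>y\<in>S. 2 * (u y t \<bullet> B y t))"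
      using that by simp
    also have "\<dots> \<le> (\<Sum>y\<in>S. 2 * (M y * E t))"
    proof (intro sum_mono mult_left_mono)
      fix y assume y: "y \<in> S"
      have "u y t \<bullet> B y t \<le> norm (u y t) * norm (B y t)"
        by (rule norm_cauchy_schwarz)
      also have "\<dots> \<le> sqrt (E t) * (M y * sqrt (E t))"
        using u_le[OF y] B_le[OF that y] E0 by (intro mult_mono) auto
      also have "\<dots> = M y * E t" using E0 by simp
      finally show "u y t \<bullet> B y t \<le> M y * E t" .
    qed simp
    finally show ?thesis by (simp add: sum_distrib_left sum_distrib_right mult.assoc)
  qed
  have "continuous_on {0..1} E"
    using E' DERIV_isCont continuous_at_imp_continuous_on by blast
  moreover have "E 0 = 0" by (simp add: E_def u_def f0)
  ultimately have "E 1 \<le> 0"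
    using E' E'_le by (rule gronwall_zero)
  moreover have "norm (u x 1) \<le> sqrt (E 1)" by (rule u_le[OF S(2)])
  ultimately have "norm (u x 1) \<le> 0" by (smt (verit) real_sqrt_le_0_iff)
  then show ?thesis by (simp add: u_def)
qed

section \<open>Real-analytic functions are differentiable\<close>

lemma has_derivative_zero_quadratic:
  fixes f :: "'a::real_normed_vector \<Rightarrow> 'b::real_normed_vector"
  assumes "0 < r" and bound: "\<And>x. dist x a < r \<Longrightarrow> norm (f x) \<le> K * norm (x - a) ^ 2"
  shows "(f has_derivative (\<lambda>_. 0)) (at a)"
proof -
  have fa: "f a = 0" using bound[of a] assms(1) by simp
  have "(\<lambda>x. norm (f x - f a - 0) / norm (x - a)) \<midarrow>a\<rightarrow> 0"
  proof (rule Lim_null_comparison)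
    have "norm (norm (f x - f a - 0) / norm (x - a)) \<le> K * norm (x - a)" if "x \<noteq> a" "dist x a < r" for x
      using bound[OF that(2)] that(1) fa by (simp add: field_simps power2_eq_square)
    then show "\<forall>\<^sub>F x in at a. norm (norm (f x - f a - 0) / norm (x - a)) \<le> K * norm (x - a)"
      using assms(1) unfolding eventually_at by blast
    show "(\<lambda>x. K * norm (x - a)) \<midarrow>a\<rightarrow> 0"
      by (auto intro!: tendsto_eq_intros)
  qed
  then show ?thesis
    by (simp add: has_derivative_iff_norm)
qed

lemma differentiable_prod:
  fixes f :: "'i \<Rightarrow> 'a::real_normed_vector \<Rightarrow> 'b::real_normed_field"
  assumes "\<And>i. i \<in> I \<Longrightarrow> f i differentiable at x"
  shows "(\<lambda>y. \<Prod>i\<in>I. f i y) differentiable at x"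
  using assms
  by (induction I rule: infinite_finite_induct) (auto intro: differentiable_mult)

text \<open>At the centre of its power series \<open>f\<close> is a polynomial of degree at most one up to an error
  of second order. The constant in the error bound comes from absolute convergence at one point
  \<open>p\<close> of the ball all of whose coordinates equal \<open>s > 0\<close>: there a monomial of
  degree \<open>d\<close> takes the value \<open>s\<^sup>d\<close>, so for \<open>norm y \<le> s\<close> and
  \<open>d \<ge> 2\<close> its absolute value at \<open>y\<close> is at most
  \<open>(norm y / s)\<^sup>2\<close> times that.\<close>

lemma real_analytic_differentiable:
  fixes f :: "'a::euclidean_space \<Rightarrow> complex"
  assumes "real_analytic f"
  shows "f differentiable at a"
proof -
  define I where "I = (Basis :: 'a set) \<rightarrow>\<^sub>E (UNIV :: nat set)"
  obtain r c where "0 < r" and sums0: "\<forall>x\<in>ball a r.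
      ((\<lambda>m. c m * (\<Prod>b\<in>Basis. of_real ((x - a) \<bullet> b) ^ m b)) has_sum f x) I"
    using spec[OF assms[unfolded real_analytic_def], of a] unfolding I_def by (elim exE conjE)
  have sums: "((\<lambda>m. c m * (\<Prod>b\<in>Basis. of_real ((x - a) \<bullet> b) ^ m b)) has_sum f x) I"
    if "x \<in> ball a r" for x
    using sums0 that by (rule bspec)
  define T where "T = (\<lambda>m y. c m * (\<Prod>b\<in>Basis. of_real (y \<bullet> b) ^ m b))"
  define F where "F = {m \<in> I. sum m Basis < 2}"
  have "F \<subseteq> Basis \<rightarrow>\<^sub>E {..<2}"
    unfolding F_def I_def
  proof
    fix m :: "'a \<Rightarrow> nat"
    assume m: "m \<in> {m \<in> Basis \<rightarrow>\<^sub>E UNIV. sum m Basis < 2}"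
    have "m b < 2" if "b \<in> Basis" for b
      using member_le_sum[OF that, of m] m by simp
    then show "m \<in> Basis \<rightarrow>\<^sub>E {..<2}" using m by (simp add: PiE_iff)
  qed
  then have finF: "finite F" by (rule finite_subset) (simp add: finite_PiE)
  \<comment> \<open>the \<open>+ 1\<close> keeps \<open>p\<close> strictly inside the ball\<close>
  define N where "N = norm (\<Sum>b\<in>(Basis::'a set). b)"
  define s where "s = r / (2 * (N + 1))"
  define p where "p = s *\<^sub>R (\<Sum>b\<in>(Basis::'a set). b)"
  have "0 \<le> N" by (simp add: N_def)
  then have s: "0 < s" and "s * (N + 1) = r / 2"
    using \<open>0 < r\<close> by (simp_all add: s_def field_simps add_nonneg_pos)
  then have "norm p < r"
    using \<open>0 < r\<close> by (simp add: p_def algebra_simps flip: N_def)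
  then have "((\<lambda>m. T m p) has_sum f (a + p)) I"
    using sums[of "a + p"] by (simp add: T_def dist_norm)
  then have "(\<lambda>m. T m p) summable_on I" using has_sum_imp_summable by blast
  then have abs: "(\<lambda>m. norm (T m p)) summable_on I"
    by (rule summable_on_iff_abs_summable_on_complex[THEN iffD1])
  have pb: "p \<bullet> b = s" if "b \<in> Basis" for b
    using that by (simp add: p_def inner_sum_left inner_Basis)
  have T_p: "norm (T m p) = norm (c m) * s ^ sum m Basis" for m
    using s by (simp add: T_def norm_mult norm_power pb power_sum flip: prod_norm)
  define K where "K = (\<Sum>\<^sub>\<infinity>m\<in>I - F. norm (T m p)) / s\<^sup>2"
  define P where "P = (\<lambda>x. \<Sum>m\<in>F. T m (x - a))"
  have bound: "norm (f x - P x) \<le> K * (norm (x - a))\<^sup>2" if x: "dist x a < min s r" for x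
  proof -
    define y where "y = x - a"
    have y: "norm y \<le> s" using x by (simp add: y_def dist_norm)
    have hs: "((\<lambda>m. T m y) has_sum f x) I"
      using sums[of x] x by (simp add: T_def y_def dist_commute)
    have "((\<lambda>m. T m y) has_sum P x) F"
      using has_sum_finite[OF finF] by (simp add: P_def y_def)
    then have rest: "((\<lambda>m. T m y) has_sum (f x - P x)) (I - F)"
      by (intro has_sum_Diff[OF hs]) (auto simp: F_def)
    have term_le: "norm (T m y) \<le> norm (T m p) * ((norm y)\<^sup>2 / s\<^sup>2)" if m: "m \<in> I - F" for m
    proof -
      obtain d where d: "sum m Basis = 2 + d"
        using m le_Suc_ex[of 2 "sum m Basis"] unfolding F_def by fastforce
      have "norm (\<Prod>b\<in>Basis. (of_real (y \<bullet> b) :: complex) ^ m b) \<le> (\<Prod>b\<in>Basis. norm y ^ m b)"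
        unfolding prod_norm[symmetric] norm_power norm_of_real
        by (intro prod_mono) (auto intro!: power_mono Basis_le_norm)
      also have "\<dots> = norm y ^ (2 + d)" by (simp add: d flip: power_sum)
      also have "\<dots> \<le> (norm y)\<^sup>2 * s ^ d"
        unfolding power_add using y by (intro mult_left_mono power_mono) auto
      also have "\<dots> = (norm y)\<^sup>2 / s\<^sup>2 * s ^ sum m Basis"
        unfolding d power_add using s by simp
      finally show ?thesis
        unfolding T_p unfolding T_def norm_mult
        by (metis (no_types, lifting) mult.assoc mult.commute mult_left_mono norm_ge_zero)
    qed
    have "(\<lambda>m. norm (T m p)) summable_on (I - F)"
      using abs by (rule summable_on_subset_banach) auto
    then have sm: "(\<lambda>m. norm (T m p) * ((norm y)\<^sup>2 / s\<^sup>2)) summable_on (I - F)"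
      by (rule summable_on_cmult_left)
    have "norm (f x - P x) \<le> (\<Sum>\<^sub>\<infinity>m\<in>I - F. norm (T m p) * ((norm y)\<^sup>2 / s\<^sup>2))"
      by (rule norm_infsum_le[OF rest has_sum_infsum[OF sm]]) (rule term_le)
    also have "\<dots> = K * (norm y)\<^sup>2"
      unfolding infsum_cmult_left' by (simp add: K_def)
    finally show ?thesis by (simp only: y_def)
  qed
  have "((\<lambda>x. f x - P x) has_derivative (\<lambda>_. 0)) (at a)"
    using bound s \<open>0 < r\<close> by (intro has_derivative_zero_quadratic[of "min s r"]) auto
  then have 1: "(\<lambda>x. f x - P x) differentiable at a"
    using differentiable_def by blast
  have "(\<lambda>x. (complex_of_real ((x - a) \<bullet> b)) ^ n) differentiable at a" for b n
    unfolding differentiable_def by (rule exI) (auto intro!: derivative_eq_intros)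
  then have 2: "P differentiable at a"
    unfolding P_def T_def
    by (intro differentiable_sum differentiable_mult differentiable_prod finF ballI) simp_all
  show ?thesis using differentiable_add[OF 1 2] by simp
qed

section \<open>Eigenfunctions are multiples of the kernel\<close>

lemma cherednik_kernelD:
  assumes "is_cherednik_kernel Rp k \<mu> g"
  shows "g differentiable at x" "g 0 = 1"
    "cherednik_operator Rp k x g x = cbilin \<mu> (cvec x) * g x"
  using assms real_analytic_differentiable unfolding is_cherednik_kernel_def by auto

lemma radial_eigenfunction_eq_kernel:
  assumes R: "integral_root_system R" "positive_system R Rp" "\<forall>\<alpha>\<in>R. 0 \<le> Re (k \<alpha>)"
    and g: "is_cherednik_kernel Rp k \<mu> g"
    and f: "\<And>x. f differentiable at x"
      "\<And>x. cherednik_operator Rp k x f x = cbilin \<mu> (cvec x) * f x"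
  shows "f x = f 0 * g x"
proof -
  have sub: "Rp \<subseteq> R" using positive_roots_subset R by blast
  have g': "g differentiable at x" "g 0 = 1"
    "cherednik_operator Rp k x g x = cbilin \<mu> (cvec x) * g x" for x
    using cherednik_kernelD[OF g] by auto
  have "1 * f x + (- f 0) * g x = 0"
  proof (rule radial_eigenfunction_zero[OF R(1) sub, of k "\<lambda>x. 1 * f x + (- f 0) * g x" \<mu>])
    show "(\<lambda>x. 1 * f x + (- f 0) * g x) differentiable at x" for x
      using f(1) g'(1) by (intro differentiable_add differentiable_mult differentiable_const)
    show "cherednik_operator Rp k x (\<lambda>x. 1 * f x + (- f 0) * g x) x =
        cbilin \<mu> (cvec x) * (1 * f x + (- f 0) * g x)" for x
      unfolding radial_cherednik_operator_linear[OF f(1) g'(1)] f(2) g'(3)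
      by (simp add: algebra_simps)
  qed (use R(3) sub g'(2) in auto)
  then show ?thesis by simp
qed

section \<open>Simple reflections\<close>

lemma reflect_act_derivative:
  fixes g :: "'a::euclidean_space \<Rightarrow> complex"
  assumes "\<And>x. g differentiable at x"
  shows "(reflect_act \<alpha> g has_derivative
    (\<lambda>h. frechet_derivative g (at (reflect \<alpha> x)) (reflect \<alpha> h))) (at x)"
proof -
  have "(reflect \<alpha> has_derivative reflect \<alpha>) (at x)"
    by (intro bounded_linear_imp_has_derivative bounded_linear_reflect)
  from has_derivative_compose[OF this frechet_derivative_works[THEN iffD1, OF assms]]
  show ?thesis by (simp add: reflect_act_def[abs_def])
qed

text \<open>The relation \<open>D\<^sub>\<xi> s\<^sub>j = s\<^sub>j D\<^bsub>s\<^sub>j \<xi>\<^esub> - k\<^sub>j \<langle>\<alpha>\<^sub>j, \<xi>\<rangle>\<close> of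
  the graded Hecke algebra, in radial form. The summands of the two operators match except for those
  positive roots that \<open>s\<^sub>j\<close> makes negative; each of these changes sign and contributes
  the correction from \<open>cherednik_term_minus\<close>.\<close>

lemma cherednik_operator_reflect_act:
  fixes g :: "'a::euclidean_space \<Rightarrow> complex"
  assumes R: "integral_root_system R" "positive_system R Rp"
    and k: "multiplicity_function R k" and \<alpha>: "\<alpha> \<in> simple_roots Rp"
    and diff: "\<And>x. g differentiable at x"
  shows "cherednik_operator Rp k x (reflect_act \<alpha> g) x =
    cherednik_operator Rp k (reflect \<alpha> x) g (reflect \<alpha> x)
      - simple_multiplicity R k \<alpha> * of_real (\<alpha> \<bullet> x) * g x"
proof -
  define y where "y = reflect \<alpha> x"
  have \<alpha>R: "\<alpha> \<in> R" "\<alpha> \<noteq> 0"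
    using \<alpha> positive_roots_subset[OF R] zero_notin_roots[OF R] by (auto simp: simple_roots_def)
  define N where "N = {\<gamma> \<in> Rp. reflect \<alpha> \<gamma> \<notin> Rp}"
  have N: "N = {\<alpha>, 2 *\<^sub>R \<alpha>} \<inter> R"
    unfolding N_def using R \<alpha> by (rule simple_reflection_inversions)
  have "k \<gamma> * cherednik_term \<gamma> (reflect_act \<alpha> g) x =
      k (positive_reflection Rp \<alpha> \<gamma>) * cherednik_term (positive_reflection Rp \<alpha> \<gamma>) g y
      - (if \<gamma> \<in> N then k \<gamma> * of_real (\<gamma> \<bullet> x) * g x else 0)" if "\<gamma> \<in> Rp" for \<gamma>
  proof (cases "\<gamma> \<in> N")
    case True
    then obtain c where c: "\<gamma> = c *\<^sub>R \<alpha>" "c \<noteq> 0" unfolding N by force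
    then have "reflect \<alpha> \<gamma> = - \<gamma>" using \<alpha>R by (simp add: reflect_scaleR reflect_self)
    moreover have "reflect \<gamma> y = x" "\<gamma> \<bullet> y = - (\<gamma> \<bullet> x)"
      using c \<alpha>R by (simp_all add: reflect_scaled_root y_def reflect_self reflect_scaleR flip: inner_reflect_swap)
    ultimately show ?thesis
      using True multiplicity_positive_reflection[OF R k \<alpha>R(1) that]
      by (simp add: cherednik_term_reflect cherednik_term_minus positive_reflection_def N_def
          algebra_simps flip: y_def)
  next
    case False
    then show ?thesis
      using that multiplicity_positive_reflection[OF R k \<alpha>R(1) that]
      by (simp add: cherednik_term_reflect positive_reflection_def N_def flip: y_def)
  qed
  then have "(\<Sum>\<gamma>\<in>Rp. k \<gamma> * cherednik_term \<gamma> (reflect_act \<alpha> g) x) =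
      (\<Sum>\<gamma>\<in>Rp. k \<gamma> * cherednik_term \<gamma> g y)
      - (\<Sum>\<gamma>\<in>Rp. if \<gamma> \<in> N then k \<gamma> * of_real (\<gamma> \<bullet> x) * g x else 0)"
    using sum_positive_reflection[OF R \<alpha>R(1), of "\<lambda>\<gamma>. k \<gamma> * cherednik_term \<gamma> g y"]
    by (simp add: sum_subtractf)
  also have "(\<Sum>\<gamma>\<in>Rp. if \<gamma> \<in> N then k \<gamma> * of_real (\<gamma> \<bullet> x) * g x else 0) =
      (\<Sum>\<gamma>\<in>N. k \<gamma> * of_real (\<gamma> \<bullet> x) * g x)"
    by (intro sum.mono_neutral_cong_right finite_positive_roots[OF R]) (auto simp: N_def)
  also have "\<dots> = simple_multiplicity R k \<alpha> * of_real (\<alpha> \<bullet> x) * g x"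
  proof (cases "2 *\<^sub>R \<alpha> \<in> R")
    case True
    then have "N = {\<alpha>, 2 *\<^sub>R \<alpha>}" "\<alpha> \<noteq> 2 *\<^sub>R \<alpha>" using N \<alpha>R by (auto simp: scaleR_2)
    then show ?thesis using True by (simp add: simple_multiplicity_def algebra_simps)
  next
    case False
    then have "N = {\<alpha>}" using N \<alpha>R(1) by auto
    then show ?thesis using False by (simp add: simple_multiplicity_def)
  qed
  finally show ?thesis
    unfolding radial_cherednik_operator
      frechet_derivative_at[OF reflect_act_derivative[OF diff], symmetric]
    by (simp add: y_def)
qed

lemma kernel_simple_reflection:
  assumes R: "integral_root_system R" "positive_system R Rp" "multiplicity_function R k"
      "\<forall>\<alpha>\<in>R. 0 \<le> Re (k \<alpha>)"
    and G: "\<forall>\<mu>. is_cherednik_kernel Rp k \<mu> (G \<mu>)"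
    and \<alpha>: "\<alpha> \<in> simple_roots Rp" and \<mu>: "cbilin \<mu> (cvec \<alpha>) \<noteq> 0"
  shows "(1 + simple_multiplicity R k \<alpha> / cbilin \<mu> (cvec (coroot \<alpha>))) * G (creflect \<alpha> \<mu>) x
    = reflect_act \<alpha> (G \<mu>) x + simple_multiplicity R k \<alpha> / cbilin \<mu> (cvec (coroot \<alpha>)) * G \<mu> x"
proof -
  define m where "m = cbilin \<mu> (cvec (coroot \<alpha>))"
  define K where "K = simple_multiplicity R k \<alpha>"
  define f where "f = (\<lambda>x. 1 * reflect_act \<alpha> (G \<mu>) x + K / m * G \<mu> x)"
  have "\<alpha> \<noteq> 0"
    using \<alpha> positive_roots_subset[OF R(1,2)] zero_notin_roots[OF R(1,2)]
    by (auto simp: simple_roots_def)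
  then have m: "m \<noteq> 0" using \<mu> by (simp add: m_def coroot_def cbilin_scaleR_right)
  have g: "G \<mu> differentiable at x" "G \<mu> 0 = 1"
    "cherednik_operator Rp k x (G \<mu>) x = cbilin \<mu> (cvec x) * G \<mu> x" for x
    using cherednik_kernelD[OF G[rule_format, of \<mu>]] by auto
  have sg: "reflect_act \<alpha> (G \<mu>) differentiable at x" for x
    using reflect_act_derivative[OF g(1)] differentiable_def by blast
  have "f x = f 0 * G (creflect \<alpha> \<mu>) x"
  proof (rule radial_eigenfunction_eq_kernel[OF R(1,2,4) G[rule_format]])
    show "f differentiable at x" for x
      unfolding f_def using g(1) sg by (intro differentiable_add differentiable_mult differentiable_const)
    show "cherednik_operator Rp k x f x = cbilin (creflect \<alpha> \<mu>) (cvec x) * f x" for x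
    proof -
      have "cherednik_operator Rp k x f x =
          cbilin \<mu> (cvec (reflect \<alpha> x)) * reflect_act \<alpha> (G \<mu>) x - K * of_real (\<alpha> \<bullet> x) * G \<mu> x
          + K / m * (cbilin \<mu> (cvec x) * G \<mu> x)"
        unfolding f_def radial_cherednik_operator_linear[OF sg g(1)]
          cherednik_operator_reflect_act[OF R(1-3) \<alpha> g(1)] g(3)
        by (simp add: reflect_act_def K_def)
      \<comment> \<open>the factor \<open>K / m\<close> is the one for which the correction is absorbed by
        \<open>\<langle>\<mu>, x\<rangle> - \<langle>\<mu>, s\<^sub>\<alpha> x\<rangle> = m \<langle>\<alpha>, x\<rangle>\<close>\<close>
      also have "\<dots> = cbilin \<mu> (cvec (reflect \<alpha> x)) * f x"
        unfolding cbilin_reflect f_def m_def[symmetric] using m by (simp add: field_simps)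
      finally show ?thesis by (simp add: cbilin_creflect)
    qed
  qed
  moreover have "f 0 = 1 + K / m"
    by (simp add: f_def reflect_act_def reflect_orthogonal g(2))
  ultimately show ?thesis by (simp add: f_def K_def m_def)
qed

section \<open>The affine reflection\<close>

text \<open>By dominance \<open>\<langle>\<alpha>\<^sup>\<or>, \<beta>\<rangle> \<ge> 0\<close>, and since \<open>\<beta>\<close> is not longer than
  \<open>\<alpha>\<close>, expanding \<open>\<bar>\<alpha> - \<beta>\<bar>\<^sup>2 > 0\<close> shows that this integer is less
  than \<open>2\<close>. Roots outside the component of \<open>\<beta>\<close> are orthogonal to it.\<close>

lemma highest_short_root_quasiminuscule:
  assumes R: "integral_root_system R" "positive_system R Rp"
    and C: "irreducible_component R C" and \<beta>: "highest_short_root C (C \<inter> Rp) \<beta>"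
  shows "\<beta> \<in> Rp"
    and "\<alpha> \<in> Rp \<Longrightarrow> \<alpha> \<noteq> \<beta> \<Longrightarrow> coroot \<alpha> \<bullet> \<beta> = 0 \<or> coroot \<alpha> \<bullet> \<beta> = 1"
proof -
  have CR: "C \<subseteq> R" and orth: "\<And>\<alpha>. \<alpha> \<in> R - C \<Longrightarrow> \<beta> \<bullet> \<alpha> = 0"
    using C \<beta> unfolding irreducible_component_def orthogonal_sets_def highest_short_root_def by auto
  have \<beta>C: "\<beta> \<in> C" and short: "\<And>\<alpha>. \<alpha> \<in> C \<Longrightarrow> norm \<beta> \<le> norm \<alpha>"
    and dom: "\<And>\<alpha>. \<alpha> \<in> C \<Longrightarrow> \<alpha> \<in> Rp \<Longrightarrow> 0 \<le> \<alpha> \<bullet> \<beta>"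
    using \<beta> unfolding highest_short_root_def closed_chamber_def by auto
  have \<beta>0: "\<beta> \<noteq> 0" "\<beta> \<in> R" using \<beta>C CR zero_notin_roots[OF R] by auto
  show "\<beta> \<in> Rp"
  proof (rule ccontr)
    assume "\<beta> \<notin> Rp"
    then have "- \<beta> \<in> Rp" using uminus_in_positive[OF R \<beta>0(2)] by blast
    then have "- \<beta> \<in> C \<Longrightarrow> \<beta> \<bullet> \<beta> \<le> 0" "- \<beta> \<notin> C \<Longrightarrow> \<beta> \<bullet> \<beta> = 0"
      using dom[of "- \<beta>"] orth[of "- \<beta>"] uminus_in_roots[OF R \<beta>0(2)] by simp_all
    then show False using \<beta>0(1) by (metis inner_gt_zero_iff not_less order_refl)
  qed
  show "coroot \<alpha> \<bullet> \<beta> = 0 \<or> coroot \<alpha> \<bullet> \<beta> = 1" if \<alpha>: "\<alpha> \<in> Rp" "\<alpha> \<noteq> \<beta>"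
  proof (cases "\<alpha> \<in> C")
    case False
    then have "\<alpha> \<bullet> \<beta> = 0"
      using orth[of \<alpha>] \<alpha> positive_roots_subset[OF R] by (auto simp: inner_commute)
    then show ?thesis by (simp add: inner_coroot)
  next
    case True
    then have a0: "0 < \<alpha> \<bullet> \<alpha>" using CR zero_notin_roots[OF R] by auto
    obtain n where n: "coroot \<alpha> \<bullet> \<beta> = real_of_int n"
      using coroot_inner_Ints[OF R] True CR \<beta>0 by (metis Ints_cases subsetD)
    have "0 \<le> coroot \<alpha> \<bullet> \<beta>" using dom[OF True \<alpha>(1)] a0 by (simp add: inner_coroot)
    moreover have "coroot \<alpha> \<bullet> \<beta> < 2"
    proof -
      have "0 < (\<alpha> - \<beta>) \<bullet> (\<alpha> - \<beta>)" using \<alpha>(2) by simp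
      also have "\<dots> = \<alpha> \<bullet> \<alpha> - 2 * (\<alpha> \<bullet> \<beta>) + \<beta> \<bullet> \<beta>"
        by (simp add: inner_diff_left inner_diff_right inner_commute)
      also have "\<beta> \<bullet> \<beta> \<le> \<alpha> \<bullet> \<alpha>" using short[OF True] by (simp add: norm_le)
      finally show ?thesis using a0 by (simp add: inner_coroot divide_less_eq)
    qed
    ultimately have "n = 0 \<or> n = 1" using n by auto
    then show ?thesis using n by auto
  qed
qed

lemma exp_reflect_act_derivative:
  fixes g :: "'a::euclidean_space \<Rightarrow> complex"
  assumes "\<And>x. g differentiable at x"
  shows "(exp_reflect_act \<beta> g has_derivative
    (\<lambda>h. of_real (exp (\<beta> \<bullet> x)) * (of_real (\<beta> \<bullet> h) * g (reflect \<beta> x)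
      + frechet_derivative g (at (reflect \<beta> x)) (reflect \<beta> h)))) (at x)"
proof -
  have "((\<lambda>x. of_real (exp (\<beta> \<bullet> x)) * reflect_act \<beta> g x) has_derivative
    (\<lambda>h. of_real (exp (\<beta> \<bullet> x)) * frechet_derivative g (at (reflect \<beta> x)) (reflect \<beta> h)
      + of_real (exp (\<beta> \<bullet> x) * (\<beta> \<bullet> h)) * reflect_act \<beta> g x)) (at x)"
    by (rule derivative_eq_intros reflect_act_derivative[OF assms] refl)+ (simp add: algebra_simps)
  then show ?thesis
    by (simp add: exp_reflect_act_def[abs_def] reflect_act_def algebra_simps)
qed

lemma cherednik_term_exp_reflect_act:
  "cherednik_term \<alpha> (exp_reflect_act \<beta> g) x = of_real (exp (\<beta> \<bullet> x)) *
    (of_real (todd (\<alpha> \<bullet> x)) * (g (reflect \<beta> x) - of_real (exp (- (coroot \<alpha> \<bullet> \<beta>) * (\<alpha> \<bullet> x)))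
        * g (reflect (reflect \<beta> \<alpha>) (reflect \<beta> x)))
      - of_real (\<alpha> \<bullet> x) / 2 * g (reflect \<beta> x))"
proof -
  have "exp (\<beta> \<bullet> reflect \<alpha> x) = exp (\<beta> \<bullet> x) * exp (- (coroot \<alpha> \<bullet> \<beta>) * (\<alpha> \<bullet> x))"
    by (simp add: inner_reflect flip: exp_add)
  then show ?thesis
    by (simp add: cherednik_term_def exp_reflect_act_def reflect_conjugate[of \<beta> \<alpha>] algebra_simps)
qed

text \<open>The affine counterpart of \<open>cherednik_operator_reflect_act\<close>. Pair the summand for
  \<open>\<alpha>\<close> with the one for \<open>\<plusminus> s\<^sub>\<beta> \<alpha>\<close>. If \<open>\<alpha>\<close> is
  orthogonal to \<open>\<beta>\<close>, nothing changes. If \<open>\<langle>\<alpha>\<^sup>\<or>, \<beta>\<rangle> = 1\<close>, then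
  \<open>s\<^sub>\<beta> \<alpha>\<close> is negative, as its coroot pairs negatively with \<open>\<beta>\<close>, and the
  correction for the change of sign cancels the factor \<open>e\<^sup>-\<^sup>\<alpha>\<close> that the twist
  introduces, because \<open>todd z * (1 - e\<^sup>-\<^sup>z) = z\<close>. For \<open>\<alpha> = \<beta>\<close> the
  factor is \<open>e\<^sup>-\<^sup>2\<^sup>\<beta>\<close>, which overcompensates and leaves the last term.\<close>

lemma cherednik_operator_exp_reflect_act:
  fixes g :: "'a::euclidean_space \<Rightarrow> complex"
  assumes R: "integral_root_system R" "positive_system R Rp"
    and k: "multiplicity_function R k" and \<beta>: "\<beta> \<in> Rp"
    and minuscule: "\<And>\<alpha>. \<alpha> \<in> Rp \<Longrightarrow> \<alpha> \<noteq> \<beta> \<Longrightarrow> coroot \<alpha> \<bullet> \<beta> = 0 \<or> coroot \<alpha> \<bullet> \<beta> = 1"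
    and diff: "\<And>x. g differentiable at x"
  shows "cherednik_operator Rp k x (exp_reflect_act \<beta> g) x =
    of_real (exp (\<beta> \<bullet> x)) * cherednik_operator Rp k (reflect \<beta> x) g (reflect \<beta> x)
      + of_real (\<beta> \<bullet> x) * exp_reflect_act \<beta> g x + k \<beta> * of_real (\<beta> \<bullet> x) * g x"
proof -
  define y where "y = reflect \<beta> x"
  define e :: complex where "e = of_real (exp (\<beta> \<bullet> x))"
  have \<beta>R: "\<beta> \<in> R" "\<beta> \<noteq> 0"
    using \<beta> positive_roots_subset[OF R] zero_notin_roots[OF R] by auto
  have todd': "of_real (todd z) * (1 - of_real (exp (- z))) = (of_real z :: complex)" for z
    using arg_cong[OF todd_mult[of z], of complex_of_real] by simp
  have "k \<alpha> * cherednik_term \<alpha> (exp_reflect_act \<beta> g) x =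
      e * (k (positive_reflection Rp \<beta> \<alpha>) * cherednik_term (positive_reflection Rp \<beta> \<alpha>) g y)
      + (if \<alpha> = \<beta> then k \<beta> * of_real (\<beta> \<bullet> x) * g x else 0)" if \<alpha>: "\<alpha> \<in> Rp" for \<alpha>
  proof -
    define \<gamma> where "\<gamma> = reflect \<beta> \<alpha>"
    define z where "z = \<alpha> \<bullet> x"
    have \<alpha>R: "\<alpha> \<in> R" "0 < \<alpha> \<bullet> \<alpha>"
      using \<alpha> positive_roots_subset[OF R] zero_notin_roots[OF R] by auto
    have \<gamma>R: "\<gamma> \<in> R" using reflect_in_roots[OF R \<beta>R(1) \<alpha>R(1)] by (simp add: \<gamma>_def)
    have \<gamma>y: "\<gamma> \<bullet> y = z" by (simp add: \<gamma>_def y_def z_def inner_reflect_reflect)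
    note keq = multiplicity_positive_reflection[OF R k \<beta>R(1) \<alpha>]
    have lhs: "cherednik_term \<alpha> (exp_reflect_act \<beta> g) x = e * (of_real (todd z) *
        (g y - of_real (exp (- (coroot \<alpha> \<bullet> \<beta>) * z)) * g (reflect \<gamma> y)) - of_real z / 2 * g y)"
      by (simp only: cherednik_term_exp_reflect_act e_def z_def y_def \<gamma>_def)
    have rhs: "cherednik_term (- \<gamma>) g y = of_real (todd z) * (g y - g (reflect \<gamma> y))
        - of_real z / 2 * g y + of_real z * g (reflect \<gamma> y)"
      unfolding cherednik_term_minus by (simp add: cherednik_term_def \<gamma>y)
    consider "\<alpha> = \<beta>" | "\<alpha> \<noteq> \<beta>" "coroot \<alpha> \<bullet> \<beta> = 0" | "\<alpha> \<noteq> \<beta>" "coroot \<alpha> \<bullet> \<beta> = 1"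
      using minuscule \<alpha> by blast
    then show ?thesis
    proof cases
      case 2
      then have "\<alpha> \<bullet> \<beta> = 0" using \<alpha>R by (simp add: inner_coroot)
      then have "\<gamma> = \<alpha>" by (simp add: \<gamma>_def reflect_orthogonal inner_commute)
      then have pr: "positive_reflection Rp \<beta> \<alpha> = \<alpha>"
        using \<alpha> by (simp add: positive_reflection_def flip: \<gamma>_def)
      have "cherednik_term \<alpha> (exp_reflect_act \<beta> g) x = e * cherednik_term \<alpha> g y"
        using \<gamma>y unfolding lhs 2(2) \<open>\<gamma> = \<alpha>\<close> by (simp add: cherednik_term_def)
      then show ?thesis using 2(1) by (simp add: pr)
    next
      case 3
      have "0 < \<alpha> \<bullet> \<beta>" using 3(2) \<alpha>R by (simp add: inner_coroot field_simps)
      \<comment> \<open>a positive \<open>\<gamma>\<close> would pair nonnegatively with \<open>\<beta>\<close>\<close>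
      have "\<gamma> \<notin> Rp"
      proof
        assume \<gamma>p: "\<gamma> \<in> Rp"
        have "\<gamma> \<bullet> \<beta> < 0"
          using \<open>0 < \<alpha> \<bullet> \<beta>\<close> \<beta>R by (simp add: \<gamma>_def inner_reflect_swap reflect_self)
        moreover have "\<gamma> \<noteq> \<beta>" using calculation by (metis inner_ge_zero not_less)
        moreover have "0 < \<gamma> \<bullet> \<gamma>" using \<gamma>R zero_notin_roots[OF R] by auto
        then have "coroot \<gamma> \<bullet> \<beta> < 0"
          using calculation(1) by (simp add: inner_coroot divide_neg_pos)
        ultimately show False using minuscule[OF \<gamma>p] by auto
      qed
      then have pr: "positive_reflection Rp \<beta> \<alpha> = - \<gamma>"
        by (simp add: positive_reflection_def flip: \<gamma>_def)
      have "cherednik_term \<alpha> (exp_reflect_act \<beta> g) x - e * cherednik_term (- \<gamma>) g y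
          = e * (of_real (todd z) * (1 - of_real (exp (- z))) - of_real z) * g (reflect \<gamma> y)"
        unfolding lhs rhs 3(2) by (simp add: algebra_simps)
      then have "cherednik_term \<alpha> (exp_reflect_act \<beta> g) x = e * cherednik_term (- \<gamma>) g y"
        by (simp add: todd')
      then show ?thesis using 3(1) keq by (simp add: pr)
    next
      case 1
      have \<gamma>: "\<gamma> = - \<beta>" using 1 \<beta>R by (simp add: \<gamma>_def reflect_self)
      have n: "coroot \<beta> \<bullet> \<beta> = 2" using \<beta>R by (simp add: inner_coroot)
      have pr: "positive_reflection Rp \<beta> \<beta> = \<beta>"
        using 1 \<gamma> \<beta> uminus_notin_positive[OF R \<beta>] by (simp add: positive_reflection_def \<gamma>_def)
      have x: "reflect \<gamma> y = x" by (simp add: \<gamma> y_def)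
      have e: "e * of_real (exp (- 2 * z)) = of_real (exp (- z))" "e * of_real (exp (- z)) = 1"
        using 1 by (simp_all add: e_def z_def flip: exp_add of_real_mult)
      have "cherednik_term \<beta> (exp_reflect_act \<beta> g) x - e * cherednik_term \<beta> g y
          = (of_real (todd z) * (e - e * of_real (exp (- 2 * z))) - of_real z * e) * g x"
        unfolding lhs[unfolded 1 n x] rhs[unfolded x, unfolded \<gamma> minus_minus]
        by (simp add: algebra_simps)
      also have "e - e * of_real (exp (- 2 * z)) = (1 - of_real (exp (- z))) * (e + 1)"
        unfolding e(1) using e(2) by (simp add: algebra_simps)
      also have "of_real (todd z) * ((1 - of_real (exp (- z))) * (e + 1)) = of_real z * (e + 1)"
        unfolding mult.assoc[symmetric] todd' ..
      also have "(of_real z * (e + 1) - of_real z * e) * g x = of_real z * g x"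
        by (simp add: algebra_simps)
      finally show ?thesis using 1 keq by (simp add: pr z_def algebra_simps)
    qed
  qed
  then have "(\<Sum>\<alpha>\<in>Rp. k \<alpha> * cherednik_term \<alpha> (exp_reflect_act \<beta> g) x) =
      e * (\<Sum>\<alpha>\<in>Rp. k \<alpha> * cherednik_term \<alpha> g y)
      + (\<Sum>\<alpha>\<in>Rp. if \<alpha> = \<beta> then k \<beta> * of_real (\<beta> \<bullet> x) * g x else 0)"
    using sum_positive_reflection[OF R \<beta>R(1), of "\<lambda>\<alpha>. k \<alpha> * cherednik_term \<alpha> g y"]
    by (simp add: sum.distrib flip: sum_distrib_left)
  then show ?thesis
    unfolding radial_cherednik_operator
      frechet_derivative_at[OF exp_reflect_act_derivative[OF diff], symmetric]
    using \<beta> finite_positive_roots[OF R]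
    by (simp add: exp_reflect_act_def e_def y_def algebra_simps)
qed

lemma kernel_affine_reflection:
  assumes R: "integral_root_system R" "positive_system R Rp" "multiplicity_function R k"
      "\<forall>\<alpha>\<in>R. 0 \<le> Re (k \<alpha>)"
    and G: "\<forall>\<mu>. is_cherednik_kernel Rp k \<mu> (G \<mu>)"
    and C: "irreducible_component R C" and \<beta>: "highest_short_root C (C \<inter> Rp) \<beta>"
    and \<mu>: "cbilin \<mu> (cvec (coroot \<beta>)) \<noteq> 1"
  shows "(1 + k \<beta> / (1 - cbilin \<mu> (cvec (coroot \<beta>)))) * G (cvec \<beta> + creflect \<beta> \<mu>) x
    = exp_reflect_act \<beta> (G \<mu>) x + k \<beta> / (1 - cbilin \<mu> (cvec (coroot \<beta>))) * G \<mu> x"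
proof -
  define m where "m = 1 - cbilin \<mu> (cvec (coroot \<beta>))"
  have m: "m \<noteq> 0" "cbilin \<mu> (cvec (coroot \<beta>)) = 1 - m" using \<mu> by (simp_all add: m_def)
  define f where "f = (\<lambda>x. 1 * exp_reflect_act \<beta> (G \<mu>) x + k \<beta> / m * G \<mu> x)"
  note quasi = highest_short_root_quasiminuscule[OF R(1,2) C \<beta>]
  have g: "G \<mu> differentiable at x" "G \<mu> 0 = 1"
    "cherednik_operator Rp k x (G \<mu>) x = cbilin \<mu> (cvec x) * G \<mu> x" for x
    using cherednik_kernelD[OF G[rule_format, of \<mu>]] by auto
  have eg: "exp_reflect_act \<beta> (G \<mu>) differentiable at x" for x
    using exp_reflect_act_derivative[OF g(1)] differentiable_def by blast
  have operator: "cherednik_operator Rp k x (exp_reflect_act \<beta> (G \<mu>)) x =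
      of_real (exp (\<beta> \<bullet> x)) * cherednik_operator Rp k (reflect \<beta> x) (G \<mu>) (reflect \<beta> x)
      + of_real (\<beta> \<bullet> x) * exp_reflect_act \<beta> (G \<mu>) x + k \<beta> * of_real (\<beta> \<bullet> x) * G \<mu> x" for x
    using quasi g(1) by (intro cherednik_operator_exp_reflect_act[OF R(1-3)])
  have "f x = f 0 * G (cvec \<beta> + creflect \<beta> \<mu>) x"
  proof (rule radial_eigenfunction_eq_kernel[OF R(1,2,4) G[rule_format]])
    show "f differentiable at x" for x
      unfolding f_def using g(1) eg by (intro differentiable_add differentiable_mult differentiable_const)
    show "cherednik_operator Rp k x f x = cbilin (cvec \<beta> + creflect \<beta> \<mu>) (cvec x) * f x" for x
    proof -
      have "cherednik_operator Rp k x f x =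
          (of_real (\<beta> \<bullet> x) + cbilin \<mu> (cvec (reflect \<beta> x))) * exp_reflect_act \<beta> (G \<mu>) x
          + k \<beta> * of_real (\<beta> \<bullet> x) * G \<mu> x + k \<beta> / m * (cbilin \<mu> (cvec x) * G \<mu> x)"
        unfolding f_def radial_cherednik_operator_linear[OF eg g(1)]
          operator g(3)
        by (simp add: exp_reflect_act_def algebra_simps)
      \<comment> \<open>here \<open>\<langle>\<beta>, x\<rangle> + \<langle>\<mu>, s\<^sub>\<beta> x\<rangle> - \<langle>\<mu>, x\<rangle> = m \<langle>\<beta>, x\<rangle>\<close>, which
        absorbs the correction\<close>
      also have "\<dots> = (of_real (\<beta> \<bullet> x) + cbilin \<mu> (cvec (reflect \<beta> x))) * f x"
        unfolding cbilin_reflect f_def m(2) using m(1) by (simp add: field_simps)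
      finally show ?thesis by (simp add: cbilin_add_left cbilin_creflect cbilin_cvec_cvec)
    qed
  qed
  moreover have "f 0 = 1 + k \<beta> / m"
    by (simp add: f_def exp_reflect_act_def reflect_orthogonal g(2))
  ultimately show ?thesis by (simp add: f_def flip: m_def)
qed

section \<open>Both reflection identities\<close>

theorem lemma3p5:
  fixes R Rp :: "'a::euclidean_space set"
    and k :: "'a \<Rightarrow> complex"
    and G :: "'a cplx_space \<Rightarrow> 'a \<Rightarrow> complex"
  assumes "integral_root_system R"
    and "positive_system R Rp"
    and "multiplicity_function R k"
    and "\<forall>\<alpha>\<in>R. 0 \<le> Re (k \<alpha>)"
    and "\<forall>\<mu>. is_cherednik_kernel Rp k \<mu> (G \<mu>)"
  shows
    "(crystallographic_root_system R \<and> irreducible_roots R \<longrightarrow>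
       (\<forall>\<beta>. highest_short_root R Rp \<beta> \<longrightarrow>
         (\<forall>\<mu>. cbilin \<mu> (cvec (coroot \<beta>)) \<noteq> 1 \<longrightarrow>
           (\<forall>x. (1 + k \<beta> / (1 - cbilin \<mu> (cvec (coroot \<beta>)))) * G (cvec \<beta> + creflect \<beta> \<mu>) x
              = exp_reflect_act \<beta> (G \<mu>) x
                + k \<beta> / (1 - cbilin \<mu> (cvec (coroot \<beta>))) * G \<mu> x))) \<and>
       (\<forall>\<alpha>\<in>simple_roots Rp. \<forall>\<mu>. cbilin \<mu> (cvec \<alpha>) \<noteq> 0 \<longrightarrow>
         (\<forall>x. (1 + simple_multiplicity R k \<alpha> / cbilin \<mu> (cvec (coroot \<alpha>))) * G (creflect \<alpha> \<mu>) x
            = reflect_act \<alpha> (G \<mu>) x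
              + simple_multiplicity R k \<alpha> / cbilin \<mu> (cvec (coroot \<alpha>)) * G \<mu> x)))
     \<and>
     (\<forall>\<alpha>\<in>simple_roots Rp. \<forall>\<mu>. cbilin \<mu> (cvec \<alpha>) \<noteq> 0 \<longrightarrow>
       (\<forall>x. (1 + simple_multiplicity R k \<alpha> / cbilin \<mu> (cvec (coroot \<alpha>))) * G (creflect \<alpha> \<mu>) x
          = reflect_act \<alpha> (G \<mu>) x
            + simple_multiplicity R k \<alpha> / cbilin \<mu> (cvec (coroot \<alpha>)) * G \<mu> x))
     \<and>
     (\<forall>C \<beta>. irreducible_component R C \<and> highest_short_root C (C \<inter> Rp) \<beta> \<longrightarrow>
       (\<forall>\<mu>. cbilin \<mu> (cvec (coroot \<beta>)) \<noteq> 1 \<longrightarrow>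
         (\<forall>x. (1 + k \<beta> / (1 - cbilin \<mu> (cvec (coroot \<beta>)))) * G (cvec \<beta> + creflect \<beta> \<mu>) x
            = exp_reflect_act \<beta> (G \<mu>) x
              + k \<beta> / (1 - cbilin \<mu> (cvec (coroot \<beta>))) * G \<mu> x)))"
proof -
  note kernel = assms(1-5)
  have whole: "irreducible_component R R" if "irreducible_roots R"
    using that by (simp add: irreducible_component_def orthogonal_sets_def)
  have "R \<inter> Rp = Rp"
    using positive_roots_subset[OF assms(1,2)] by blast
  then show ?thesis
    using kernel_affine_reflection[OF kernel] kernel_affine_reflection[OF kernel whole]
      kernel_simple_reflection[OF kernel]
    by auto
qed

end
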